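(* Consider the zero pressure gas dynamics system $$\Delta_1:=u_t+(uv)_x=0,\qquad \Delta_2:=(uv)_t+(uv^2)_x=0$$ for unknowns $u,v$ depending on $(x,t)$. The following (local) one-parameter transformation groups acting on $(x,t,u,v)$, with group parameter $\eta$, which are symmetry groups of the system, $$G_1:(x,t,u,v)\mapsto(x+\eta,t,u,v),\qquad G_2:(x,t,u,v)\mapsto(e^\eta x,t,u,e^\eta v),$$ $$G_3:(x,t,u,v)\mapsto(x+\eta t,t,u,v+\eta),\qquad G_6:(x,t,u,v)\mapsto(x,t+\eta,u,v),$$ $$G_7:(x,t,u,v)\mapsto(x,e^\eta t,u,e^{-\eta}v),$$ $$G_8:(x,t,u,v)\mapsto\left(\frac{x}{1-\eta t},\frac{t}{1-\eta t},(1-\eta t)u,\ \eta x+(1-\eta t)v\right)\quad(\text{where }1-\eta t>0),$$ are $1$-strongly associated symmetry groups, i.e. they transform $1$-strongly associated solutions of the system into other $1$-strongly associated solutions of the system.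
   Context: Colombeau algebra: for $\Omega\subseteq\mathbb R^2$ open, $\mathcal G(\Omega)=\mathcal E_M(\Omega)/\mathcal N(\Omega)$, where $\mathcal E_M(\Omega)$ is the set of nets $(u_\varepsilon)_{\varepsilon\in(0,1]}$ in $C^\infty(\Omega)$ such that on each compact set every derivative is $O(\varepsilon^{-N})$ for some $N$, and $\mathcal N(\Omega)$ the subset of nets such that on each compact set every derivative is $O(\varepsilon^m)$ for all $m$. $1$-strongly associated solution on $\Omega$: a pair $(u,v)\in\mathcal G(\Omega)^2$ having representatives $(u_\varepsilon),(v_\varepsilon)\in\mathcal E_M(\Omega)$ such that for every $B\subseteq C_c^\infty(\Omega)$ bounded in $C_c^1(\Omega)$ (all $\varphi\in B$ supported in a common compact subset of $\Omega$, with $\varphi$ and its first derivatives bounded uniformly over $B$), $$\lim_{\varepsilon\to0}\sup_{\varphi\in B}\left|\int_\Omega\Delta_\nu[u_\varepsilon,v_\varepsilon]\,\varphi\,dx\,dt\right|=0,\quad\nu=1,2,$$ where $\Delta_\nu[u_\varepsilon,v_\varepsilon]$ is $\Delta_\nu$ evaluated at $(u_\varepsilon,v_\varepsilon)$. Action on functions: a transformation $g_\eta:(x,t,u,v)\mapsto(\Xi_\eta(x,t),\Phi_\eta(x,t,u,v))$ is called projectable; it acts on $f=(u,v)$ defined on $\Omega$ by $g_\eta f=\big(\Phi_\eta\circ(\mathrm{id}\times f)\big)\circ\Xi_\eta^{-1}$, defined on $\Xi_\eta(\Omega)$ (applied to generalized functions via representatives). For $G_8$, $g_\eta f$ is defined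 when $1-\eta t>0$ on $\Omega$. A symmetry group is a $1$-strongly associated symmetry group if $g_\eta f$ is a $1$-strongly associated solution whenever $f$ is one and $g_\eta f$ is defined. *)

theory Defs
  imports "HOL-Analysis.Analysis"
begin

section \<open>Smooth functions\<close>

definition dir_deriv ::
  "'a::euclidean_space \<Rightarrow> ('a \<Rightarrow> 'b::real_normed_vector) \<Rightarrow> 'a \<Rightarrow> 'b" where
  "dir_deriv b f = (\<lambda>p. frechet_derivative f (at p) b)"

text \<open>\<open>iter_deriv [b1, ..., bk] f\<close> differentiates first along \<open>b1\<close>, last along \<open>bk\<close>.\<close>

definition iter_deriv ::
  "'a::euclidean_space list \<Rightarrow> ('a \<Rightarrow> 'b::real_normed_vector) \<Rightarrow> 'a \<Rightarrow> 'b" where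
  "iter_deriv bs f = fold dir_deriv bs f"

text \<open>For open \<open>S\<close> this is \<open>C\<^sup>\<infinity>(S)\<close>: all iterated partial derivatives
  exist on \<open>S\<close> and are (totally) differentiable there, hence continuous. Functions are total
  in HOL; the values outside \<open>S\<close> are irrelevant.\<close>

definition smooth_on :: "'a::euclidean_space set \<Rightarrow> ('a \<Rightarrow> 'b::real_normed_vector) \<Rightarrow> bool" where
  "smooth_on S f \<longleftrightarrow>
     (\<forall>bs\<in>lists Basis. \<forall>p\<in>S. iter_deriv bs f differentiable (at p))"


section \<open>The Colombeau algebra on an open subset of the plane\<close>

text \<open>Points of the plane are pairs \<open>(x, t)\<close>. A net is a function of \<open>\<epsilon>\<close>, of which only
  the values for \<open>0 < \<epsilon> \<le> 1\<close> matter.\<close>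

type_synonym point = "real \<times> real"
type_synonym net = "real \<Rightarrow> point \<Rightarrow> real"

definition moderate_nets :: "point set \<Rightarrow> net set" where
  "moderate_nets \<Omega> = {u.
     (\<forall>\<epsilon>\<in>{0<..1}. smooth_on \<Omega> (u \<epsilon>)) \<and>
     (\<forall>K bs. compact K \<longrightarrow> K \<subseteq> \<Omega> \<longrightarrow> bs \<in> lists Basis \<longrightarrow>
        (\<exists>N::nat. \<exists>C::real. \<forall>\<^sub>F \<epsilon> in at_right 0. \<forall>p\<in>K.
           \<bar>iter_deriv bs (u \<epsilon>) p\<bar> \<le> C / \<epsilon> ^ N))}"

definition negligible_nets :: "point set \<Rightarrow> net set" where
  "negligible_nets \<Omega> = {u \<in> moderate_nets \<Omega>.
     \<forall>K bs. compact K \<longrightarrow> K \<subseteq> \<Omega> \<longrightarrow> bs \<in> lists Basis \<longrightarrow>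
        (\<forall>m::nat. \<exists>C::real. \<forall>\<^sub>F \<epsilon> in at_right 0. \<forall>p\<in>K.
           \<bar>iter_deriv bs (u \<epsilon>) p\<bar> \<le> C * \<epsilon> ^ m)}"

definition colombeau_rel :: "point set \<Rightarrow> (net \<times> net) set" where
  "colombeau_rel \<Omega> = {(u, w). u \<in> moderate_nets \<Omega> \<and> w \<in> moderate_nets \<Omega> \<and>
     (\<lambda>\<epsilon> p. u \<epsilon> p - w \<epsilon> p) \<in> negligible_nets \<Omega>}"

definition colombeau :: "point set \<Rightarrow> net set set" where
  "colombeau \<Omega> = moderate_nets \<Omega> // colombeau_rel \<Omega>"


section \<open>Zero pressure gas dynamics\<close>

abbreviation partial_x :: "(point \<Rightarrow> real) \<Rightarrow> point \<Rightarrow> real" where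
  "partial_x \<equiv> dir_deriv (1, 0)"

abbreviation partial_t :: "(point \<Rightarrow> real) \<Rightarrow> point \<Rightarrow> real" where
  "partial_t \<equiv> dir_deriv (0, 1)"

definition Delta1 :: "(point \<Rightarrow> real) \<Rightarrow> (point \<Rightarrow> real) \<Rightarrow> point \<Rightarrow> real" where
  "Delta1 u v = (\<lambda>p. partial_t u p + partial_x (\<lambda>q. u q * v q) p)"

definition Delta2 :: "(point \<Rightarrow> real) \<Rightarrow> (point \<Rightarrow> real) \<Rightarrow> point \<Rightarrow> real" where
  "Delta2 u v = (\<lambda>p. partial_t (\<lambda>q. u q * v q) p + partial_x (\<lambda>q. u q * (v q)\<^sup>2) p)"

definition classical_solution ::
  "point set \<Rightarrow> (point \<Rightarrow> real) \<Rightarrow> (point \<Rightarrow> real) \<Rightarrow> bool" where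
  "classical_solution \<Omega> u v \<longleftrightarrow> smooth_on \<Omega> u \<and> smooth_on \<Omega> v \<and>
     (\<forall>p\<in>\<Omega>. Delta1 u v p = 0 \<and> Delta2 u v p = 0)"


section \<open>1-strongly associated solutions\<close>

definition supp :: "(point \<Rightarrow> real) \<Rightarrow> point set" where
  "supp \<phi> = closure {p. \<phi> p \<noteq> 0}"

text \<open>Elements of \<open>C\<^sub>c\<^sup>\<infinity>(\<Omega>)\<close> are extended by zero to the whole plane.\<close>

definition test_functions :: "point set \<Rightarrow> (point \<Rightarrow> real) set" where
  "test_functions \<Omega> = {\<phi>. smooth_on UNIV \<phi> \<and> compact (supp \<phi>) \<and> supp \<phi> \<subseteq> \<Omega>}"

definition bounded_in_C1c :: "point set \<Rightarrow> (point \<Rightarrow> real) set \<Rightarrow> bool" where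
  "bounded_in_C1c \<Omega> B \<longleftrightarrow>
     (\<exists>K. compact K \<and> K \<subseteq> \<Omega> \<and> (\<forall>\<phi>\<in>B. supp \<phi> \<subseteq> K)) \<and>
     (\<exists>C. \<forall>\<phi>\<in>B. \<forall>p. \<bar>\<phi> p\<bar> \<le> C \<and> \<bar>partial_x \<phi> p\<bar> \<le> C \<and> \<bar>partial_t \<phi> p\<bar> \<le> C)"

text \<open>The supremum is taken in \<open>[0, \<infinity>]\<close>, so that it is meaningful without side conditions.\<close>

definition strongly_assoc_solution :: "point set \<Rightarrow> net set \<Rightarrow> net set \<Rightarrow> bool" where
  "strongly_assoc_solution \<Omega> U V \<longleftrightarrow>
     U \<in> colombeau \<Omega> \<and> V \<in> colombeau \<Omega> \<and>
     (\<exists>u\<in>U. \<exists>v\<in>V. \<forall>B. B \<subseteq> test_functions \<Omega> \<longrightarrow> bounded_in_C1c \<Omega> B \<longrightarrow>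
        (\<forall>\<Delta>\<in>{Delta1, Delta2}.
           ((\<lambda>\<epsilon>. SUP \<phi>\<in>B. ennreal \<bar>LINT p:\<Omega>|lborel. \<Delta> (u \<epsilon>) (v \<epsilon>) p * \<phi> p\<bar>)
              \<longlongrightarrow> 0) (at_right 0)))"


section \<open>Projectable one-parameter transformation groups\<close>

text \<open>The map with parameter \<open>\<eta>\<close> sends \<open>(p, w)\<close>, where \<open>p = (x, t)\<close> and \<open>w = (u, v)\<close>, to
  \<open>(Xi \<eta> p, Phi \<eta> p w)\<close>, and is defined for \<open>p \<in> Dmn \<eta>\<close> and arbitrary \<open>w\<close>.\<close>

record transformations =
  Dmn :: "real \<Rightarrow> point set"
  Xi :: "real \<Rightarrow> point \<Rightarrow> point"
  Phi :: "real \<Rightarrow> point \<Rightarrow> real \<times> real \<Rightarrow> real \<times> real"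

text \<open>The axioms of a smooth local group of transformations with parameter group \<open>(\<real>, +)\<close>.
  The last one, combined with the composition law and \<open>Dmn 0 = UNIV\<close>, makes the map with
  parameter \<open>-\<eta>\<close> the inverse of the one with parameter \<open>\<eta>\<close>.\<close>

definition local_transformation_group :: "transformations \<Rightarrow> bool" where
  "local_transformation_group G \<longleftrightarrow>
     open {(\<eta>, p). p \<in> Dmn G \<eta>} \<and> Dmn G 0 = UNIV \<and>
     smooth_on {(\<eta>, p, w). p \<in> Dmn G \<eta>} (\<lambda>(\<eta>, p, w). (Xi G \<eta> p, Phi G \<eta> p w)) \<and>
     (\<forall>p w. Xi G 0 p = p \<and> Phi G 0 p w = w) \<and>
     (\<forall>\<eta> \<mu> p w. p \<in> Dmn G \<mu> \<longrightarrow> Xi G \<mu> p \<in> Dmn G \<eta> \<longrightarrow> p \<in> Dmn G (\<eta> + \<mu>) \<longrightarrow>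
        Xi G \<eta> (Xi G \<mu> p) = Xi G (\<eta> + \<mu>) p \<and>
        Phi G \<eta> (Xi G \<mu> p) (Phi G \<mu> p w) = Phi G (\<eta> + \<mu>) p w) \<and>
     (\<forall>\<eta> p. p \<in> Dmn G \<eta> \<longrightarrow> Xi G \<eta> p \<in> Dmn G (- \<eta>))"

text \<open>\<open>act G \<eta> \<Omega> u v\<close> is \<open>g\<^sub>\<eta> f\<close> for \<open>f = (u, v)\<close> on \<open>\<Omega>\<close>; it lives on \<open>Xi G \<eta> ` \<Omega>\<close>.\<close>

definition act ::
  "transformations \<Rightarrow> real \<Rightarrow> point set \<Rightarrow> (point \<Rightarrow> real) \<Rightarrow> (point \<Rightarrow> real) \<Rightarrow> point \<Rightarrow> real \<times> real"
  where "act G \<eta> \<Omega> u v = (\<lambda>p. Phi G \<eta> p (u p, v p)) \<circ> inv_into \<Omega> (Xi G \<eta>)"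

definition act_u where "act_u G \<eta> \<Omega> u v = fst \<circ> act G \<eta> \<Omega> u v"
definition act_v where "act_v G \<eta> \<Omega> u v = snd \<circ> act G \<eta> \<Omega> u v"

text \<open>Action on generalized functions via representatives: the union of the classes of the
  transforms of all representatives. It is a single class if the transforms are moderate and
  their class does not depend on the representatives.\<close>

definition gact_u ::
  "transformations \<Rightarrow> real \<Rightarrow> point set \<Rightarrow> net set \<Rightarrow> net set \<Rightarrow> net set" where
  "gact_u G \<eta> \<Omega> U V =
     (\<Union>u\<in>U. \<Union>v\<in>V. colombeau_rel (Xi G \<eta> ` \<Omega>) `` {\<lambda>\<epsilon>. act_u G \<eta> \<Omega> (u \<epsilon>) (v \<epsilon>)})"

definition gact_v ::
  "transformations \<Rightarrow> real \<Rightarrow> point set \<Rightarrow> net set \<Rightarrow> net set \<Rightarrow> net set" where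
  "gact_v G \<eta> \<Omega> U V =
     (\<Union>u\<in>U. \<Union>v\<in>V. colombeau_rel (Xi G \<eta> ` \<Omega>) `` {\<lambda>\<epsilon>. act_v G \<eta> \<Omega> (u \<epsilon>) (v \<epsilon>)})"

text \<open>In both definitions below, \<open>\<Omega> \<subseteq> Dmn G \<eta>\<close> says that \<open>g\<^sub>\<eta> f\<close> is defined for \<open>f\<close> on \<open>\<Omega>\<close>.\<close>

definition symmetry_group :: "transformations \<Rightarrow> bool" where
  "symmetry_group G \<longleftrightarrow> local_transformation_group G \<and>
     (\<forall>\<eta> \<Omega> u v. open \<Omega> \<longrightarrow> \<Omega> \<subseteq> Dmn G \<eta> \<longrightarrow> classical_solution \<Omega> u v \<longrightarrow>
        classical_solution (Xi G \<eta> ` \<Omega>) (act_u G \<eta> \<Omega> u v) (act_v G \<eta> \<Omega> u v))"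

definition strongly_assoc_symmetry_group :: "transformations \<Rightarrow> bool" where
  "strongly_assoc_symmetry_group G \<longleftrightarrow> symmetry_group G \<and>
     (\<forall>\<eta> \<Omega> U V. open \<Omega> \<longrightarrow> \<Omega> \<subseteq> Dmn G \<eta> \<longrightarrow> strongly_assoc_solution \<Omega> U V \<longrightarrow>
        strongly_assoc_solution (Xi G \<eta> ` \<Omega>) (gact_u G \<eta> \<Omega> U V) (gact_v G \<eta> \<Omega> U V))"


section \<open>The groups\<close>

definition G1 :: transformations where
  "G1 = \<lparr>Dmn = (\<lambda>\<eta>. UNIV),
         Xi = (\<lambda>\<eta> (x, t). (x + \<eta>, t)),
         Phi = (\<lambda>\<eta> (x, t) (u, v). (u, v))\<rparr>"

definition G2 :: transformations where
  "G2 = \<lparr>Dmn = (\<lambda>\<eta>. UNIV),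
         Xi = (\<lambda>\<eta> (x, t). (exp \<eta> * x, t)),
         Phi = (\<lambda>\<eta> (x, t) (u, v). (u, exp \<eta> * v))\<rparr>"

definition G3 :: transformations where
  "G3 = \<lparr>Dmn = (\<lambda>\<eta>. UNIV),
         Xi = (\<lambda>\<eta> (x, t). (x + \<eta> * t, t)),
         Phi = (\<lambda>\<eta> (x, t) (u, v). (u, v + \<eta>))\<rparr>"

definition G6 :: transformations where
  "G6 = \<lparr>Dmn = (\<lambda>\<eta>. UNIV),
         Xi = (\<lambda>\<eta> (x, t). (x, t + \<eta>)),
         Phi = (\<lambda>\<eta> (x, t) (u, v). (u, v))\<rparr>"

definition G7 :: transformations where
  "G7 = \<lparr>Dmn = (\<lambda>\<eta>. UNIV),
         Xi = (\<lambda>\<eta> (x, t). (x, exp \<eta> * t)),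
         Phi = (\<lambda>\<eta> (x, t) (u, v). (u, exp (- \<eta>) * v))\<rparr>"

definition G8 :: transformations where
  "G8 = \<lparr>Dmn = (\<lambda>\<eta>. {(x, t). 1 - \<eta> * t > 0}),
         Xi = (\<lambda>\<eta> (x, t). (x / (1 - \<eta> * t), t / (1 - \<eta> * t))),
         Phi = (\<lambda>\<eta> (x, t) (u, v). ((1 - \<eta> * t) * u, \<eta> * x + (1 - \<eta> * t) * v))\<rparr>"

end

theory Submission
  imports Defs
begin

text \<open>All six groups consist of transformations
  \<open>X (x, t) = ((a x + b t + c) / (1 - h t), (d t + e) / (1 - h t))\<close> with an affine action on \<open>(u, v)\<close>
  that makes \<open>\<Delta>\<^sub>1\<close> and \<open>\<Delta>\<^sub>2\<close> of the transformed pair, pulled back along \<open>X\<close> and multiplied by the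
  Jacobian determinant of \<open>X\<close>, equal to \<open>a \<Delta>\<^sub>1\<close> and \<open>a (w \<Delta>\<^sub>1 + k \<Delta>\<^sub>2)\<close> with smooth \<open>w\<close>, \<open>k\<close>.
  A change of variables therefore moves the transformation onto the test functions, where it is
  \<open>\<phi> \<mapsto> \<kappa> (\<phi> \<circ> X)\<close> with smooth \<open>\<kappa>\<close>, and this preserves boundedness in \<open>C\<^sub>c\<^sup>1\<close>.\<close>

text \<open>\<open>X\<close> is the projective transformation of the plane with matrix rows (a, b,
  c), (0, d, e), (0, -h, 1). The zeros make it preserve the lines t = const, on each of which it is
  affine in x. The matrix has determinant a (d + h e), whence the Jacobian determinant a (d + h e) /
  q ^ 3. The transformed equations carry the factor q ^ 3 / (d + h e), which the Jacobian cancels up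
  to the constant a.

  Pairing with test functions does not settle that the result is a pair of generalized functions:
  the transforms of all representatives must lie in a single class. As the action is affine in (u,
  v), differences of representatives are transformed linearly, and everything rests on one estimate:
  a product of a smooth \<kappa> with f o \<Theta> inherits from f the growth bounds on compact sets
  for derivatives of every order.\<close>

section \<open>Directional derivatives: locality, algebra and the chain rule\<close>

lemma dir_deriv_eq: "(f has_derivative f') (at p) \<Longrightarrow> dir_deriv b f p = f' b"
  by (metis dir_deriv_def frechet_derivative_at)

text \<open>A derivative at a point of an open set sees only nearby values. Functions are total here
  while the rules of calculus hold only on \<open>S\<close>, so this is what permits replacing a
  derivative by its formula before differentiating again.\<close>

lemma has_derivative_cong_open:
  assumes "open S" "p \<in> S" "\<And>q. q \<in> S \<Longrightarrow> f q = g q"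
  shows "(f has_derivative f') (at p) \<longleftrightarrow> (g has_derivative f') (at p)"
  using assms by (metis has_derivative_transform_within_open)

lemma differentiable_cong_open:
  assumes "open S" "p \<in> S" "\<And>q. q \<in> S \<Longrightarrow> f q = g q"
  shows "f differentiable (at p) \<longleftrightarrow> g differentiable (at p)"
  unfolding differentiable_def using has_derivative_cong_open[OF assms] by simp

lemma dir_deriv_cong_open:
  assumes "open S" "p \<in> S" "\<And>q. q \<in> S \<Longrightarrow> f q = g q"
  shows "dir_deriv b f p = dir_deriv b g p"
  unfolding dir_deriv_def frechet_derivative_def using has_derivative_cong_open[OF assms] by simp

lemma iter_deriv_Nil [simp]: "iter_deriv [] f = f"
  and iter_deriv_Cons [simp]: "iter_deriv (b # bs) f = iter_deriv bs (dir_deriv b f)"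
  by (simp_all add: iter_deriv_def)

lemma has_derivative_dir_deriv:
  "f differentiable (at p) \<Longrightarrow> (f has_derivative (\<lambda>h. dir_deriv h f p)) (at p)"
  by (simp add: dir_deriv_def frechet_derivative_works)

lemma dir_deriv_const [simp]: "dir_deriv b (\<lambda>p. c) = (\<lambda>p. 0)"
  by (rule ext) (rule dir_deriv_eq[OF has_derivative_const])

lemma dir_deriv_linear: "bounded_linear f \<Longrightarrow> dir_deriv b f = (\<lambda>p. f b)"
  by (rule ext) (rule dir_deriv_eq[OF bounded_linear_imp_has_derivative])

lemma dir_deriv_add:
  assumes "f differentiable (at p)" "g differentiable (at p)"
  shows "dir_deriv b (\<lambda>q. f q + g q) p = dir_deriv b f p + dir_deriv b g p"
  by (rule dir_deriv_eq) (intro has_derivative_add has_derivative_dir_deriv assms)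

lemma dir_deriv_mult:
  fixes f g :: "'a::euclidean_space \<Rightarrow> real"
  assumes "f differentiable (at p)" "g differentiable (at p)"
  shows "dir_deriv b (\<lambda>q. f q * g q) p = dir_deriv b f p * g p + f p * dir_deriv b g p"
  by (subst dir_deriv_eq[OF has_derivative_mult[OF assms[THEN has_derivative_dir_deriv]]])
    (simp add: algebra_simps)

lemma dir_deriv_Pair:
  assumes "f differentiable (at p)" "g differentiable (at p)"
  shows "dir_deriv b (\<lambda>q. (f q, g q)) p = (dir_deriv b f p, dir_deriv b g p)"
  by (rule dir_deriv_eq) (intro has_derivative_Pair has_derivative_dir_deriv assms)

lemma dir_deriv_linear_compose:
  assumes "bounded_linear L" "f differentiable (at p)"
  shows "dir_deriv b (\<lambda>q. L (f q)) p = L (dir_deriv b f p)"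
  by (rule dir_deriv_eq) (rule bounded_linear.has_derivative[OF assms(1) has_derivative_dir_deriv[OF assms(2)]])

lemma differentiable_Pair:
  "f differentiable (at p) \<Longrightarrow> g differentiable (at p) \<Longrightarrow> (\<lambda>q. (f q, g q)) differentiable (at p)"
  unfolding differentiable_def by (blast intro: has_derivative_Pair)

lemma linear_dir_deriv: "f differentiable (at p) \<Longrightarrow> linear (\<lambda>h. dir_deriv h f p)"
  using has_derivative_dir_deriv has_derivative_linear by blast

text \<open>The chain rule produces derivatives along arbitrary directions, whereas smoothness and
  growth bounds speak of \<open>Basis\<close> directions only; linearity in the direction bridges
  the two.\<close>

lemma dir_deriv_components:
  fixes f :: "'a::euclidean_space \<Rightarrow> real"
  assumes "f differentiable (at p)"
  shows "dir_deriv h f p = (\<Sum>c\<in>Basis. (h \<bullet> c) * dir_deriv c f p)"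
proof -
  have "dir_deriv (\<Sum>c\<in>Basis. (h \<bullet> c) *\<^sub>R c) f p = (\<Sum>c\<in>Basis. dir_deriv ((h \<bullet> c) *\<^sub>R c) f p)"
    by (rule linear_sum[OF linear_dir_deriv[OF assms]])
  also have "\<dots> = (\<Sum>c\<in>Basis. (h \<bullet> c) * dir_deriv c f p)"
    using linear_scale[OF linear_dir_deriv[OF assms]] by simp
  finally show ?thesis by (simp add: euclidean_representation)
qed

lemma has_derivative_compose_dir_deriv:
  assumes "g differentiable (at p)" "f differentiable (at (g p))"
  shows "((\<lambda>q. f (g q)) has_derivative (\<lambda>h. dir_deriv (dir_deriv h g p) f (g p))) (at p)"
  using has_derivative_compose[OF has_derivative_dir_deriv[OF assms(1)] has_derivative_dir_deriv[OF assms(2)]]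
  by simp

lemma dir_deriv_compose:
  assumes "g differentiable (at p)" "f differentiable (at (g p))"
  shows "dir_deriv b (\<lambda>q. f (g q)) p = dir_deriv (dir_deriv b g p) f (g p)"
  by (rule dir_deriv_eq[OF has_derivative_compose_dir_deriv[OF assms]])

subsection \<open>Calculus of smooth functions\<close>

text \<open>Counting orders instead of listing directions avoids Leibniz sums: each closure rule
  becomes one induction on \<open>n\<close> in which the functions stay general.\<close>

primrec diff_order ::
  "nat \<Rightarrow> 'a::euclidean_space set \<Rightarrow> ('a \<Rightarrow> 'b::real_normed_vector) \<Rightarrow> bool" where
  "diff_order 0 S f \<longleftrightarrow> (\<forall>p\<in>S. f differentiable (at p))"
| "diff_order (Suc n) S f \<longleftrightarrow>
     (\<forall>p\<in>S. f differentiable (at p)) \<and> (\<forall>b\<in>Basis. diff_order n S (dir_deriv b f))"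

lemma diff_order_differentiable: "diff_order n S f \<Longrightarrow> p \<in> S \<Longrightarrow> f differentiable (at p)"
  by (cases n) auto

text \<open>The product rule leaves one factor undifferentiated, so that factor has to be demoted by
  one order before the induction hypothesis applies.\<close>

lemma diff_order_SucD: "diff_order (Suc n) S f \<Longrightarrow> diff_order n S f"
  by (induction n arbitrary: f) auto

lemma smooth_on_differentiable: "smooth_on S f \<Longrightarrow> p \<in> S \<Longrightarrow> f differentiable (at p)"
  unfolding smooth_on_def by (metis iter_deriv_Nil lists.Nil)

lemma smooth_on_dir_deriv: "smooth_on S f \<Longrightarrow> b \<in> Basis \<Longrightarrow> smooth_on S (dir_deriv b f)"
  unfolding smooth_on_def by (metis iter_deriv_Cons lists.Cons)

lemma smooth_on_iff_diff_order: "smooth_on S f \<longleftrightarrow> (\<forall>n. diff_order n S f)"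
proof (intro iffI allI)
  show "diff_order n S f" if "smooth_on S f" for n
    using that
    by (induction n arbitrary: f) (auto intro: smooth_on_differentiable smooth_on_dir_deriv)
next
  have "iter_deriv bs f differentiable (at p)"
    if "bs \<in> lists Basis" "p \<in> S" "diff_order (length bs) S f" for bs p
    using that by (induction bs arbitrary: f) (auto simp: diff_order_differentiable)
  then show "smooth_on S f" if "\<forall>n. diff_order n S f"
    using that by (auto simp: smooth_on_def)
qed

lemma smooth_on_subset: "smooth_on S f \<Longrightarrow> T \<subseteq> S \<Longrightarrow> smooth_on T f"
  unfolding smooth_on_def by blast

text \<open>Differentiability \<open>at p\<close> refers to full neighbourhoods, so no compatibility
  on the overlap is involved. It serves to glue a function extended by zero.\<close>

lemma smooth_on_Un: "smooth_on S f \<Longrightarrow> smooth_on T f \<Longrightarrow> smooth_on (S \<union> T) f"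
  unfolding smooth_on_def by blast

lemma smooth_on_continuous: "smooth_on S f \<Longrightarrow> continuous_on S f"
  by (meson smooth_on_differentiable continuous_at_imp_continuous_on differentiable_imp_continuous_within)

lemma diff_order_cong:
  assumes "open S" "\<And>q. q \<in> S \<Longrightarrow> f q = g q"
  shows "diff_order n S f \<longleftrightarrow> diff_order n S g"
  using assms(2)
proof (induction n arbitrary: f g)
  case 0
  then show ?case using differentiable_cong_open[OF assms(1)] by (metis diff_order.simps(1))
next
  case (Suc n)
  have "diff_order n S (dir_deriv b f) \<longleftrightarrow> diff_order n S (dir_deriv b g)" for b
    by (intro Suc.IH dir_deriv_cong_open[OF assms(1)] Suc.prems)
  moreover have "f differentiable (at p) \<longleftrightarrow> g differentiable (at p)" if "p \<in> S" for p
    by (intro differentiable_cong_open[OF assms(1) that] Suc.prems)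
  ultimately show ?case by simp
qed

lemma smooth_on_cong:
  assumes "open S" "\<And>q. q \<in> S \<Longrightarrow> f q = g q"
  shows "smooth_on S f \<longleftrightarrow> smooth_on S g"
  using diff_order_cong[OF assms] by (simp add: smooth_on_iff_diff_order)

lemma smooth_on_const [simp]: "smooth_on S (\<lambda>p. c)"
proof -
  have "diff_order n S (\<lambda>p. c)" for n
    by (induction n arbitrary: c) auto
  then show ?thesis by (simp add: smooth_on_iff_diff_order)
qed

lemma smooth_on_linear: "bounded_linear f \<Longrightarrow> smooth_on S f"
  unfolding smooth_on_iff_diff_order
proof
  fix n assume f: "bounded_linear f"
  then have "f differentiable (at p)" for p
    using bounded_linear_imp_differentiable by blast
  moreover have "diff_order m S (\<lambda>p. f b)" for m b
    using smooth_on_const smooth_on_iff_diff_order by blast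
  ultimately show "diff_order n S f"
    by (cases n) (simp_all add: dir_deriv_linear[OF f])
qed

lemma smooth_on_linear_compose:
  assumes "open S" "bounded_linear L" "smooth_on S f"
  shows "smooth_on S (\<lambda>p. L (f p))"
proof -
  have der: "(\<lambda>p. L (f p)) differentiable (at p)" if "f differentiable (at p)" for f :: "'a \<Rightarrow> 'b" and p
    by (rule differentiableI[OF bounded_linear.has_derivative[OF assms(2) has_derivative_dir_deriv[OF that]]])
  have "diff_order n S (\<lambda>p. L (f p))" if "diff_order n S f" for n
    using that
  proof (induction n arbitrary: f)
    case 0
    then show ?case using der by auto
  next
    case (Suc n)
    have "diff_order n S (dir_deriv b (\<lambda>p. L (f p)))" if "b \<in> Basis" for b
      using Suc that
      by (subst diff_order_cong[OF assms(1) dir_deriv_linear_compose[OF assms(2)]]) auto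
    then show ?case using Suc.prems der by auto
  qed
  with assms(3) show ?thesis by (simp add: smooth_on_iff_diff_order)
qed

lemma diff_order_add:
  assumes "open S" "diff_order n S f" "diff_order n S g"
  shows "diff_order n S (\<lambda>p. f p + g p)"
  using assms(2,3)
proof (induction n arbitrary: f g)
  case (Suc n)
  have "diff_order n S (dir_deriv b (\<lambda>p. f p + g p))" if "b \<in> Basis" for b
    using Suc that by (subst diff_order_cong[OF assms(1) dir_deriv_add]) auto
  then show ?case using Suc.prems by simp
qed simp

lemma diff_order_mult:
  fixes f g :: "'a::euclidean_space \<Rightarrow> real"
  assumes "open S" "diff_order n S f" "diff_order n S g"
  shows "diff_order n S (\<lambda>p. f p * g p)"
  using assms(2,3)
proof (induction n arbitrary: f g)
  case (Suc n)
  have "diff_order n S (dir_deriv b (\<lambda>p. f p * g p))" if "b \<in> Basis" for b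
    using Suc that diff_order_SucD[OF Suc.prems(1)] diff_order_SucD[OF Suc.prems(2)]
    by (subst diff_order_cong[OF assms(1) dir_deriv_mult]) (auto intro!: diff_order_add assms(1))
  then show ?case using Suc.prems by simp
qed simp

lemma diff_order_Pair:
  assumes "open S" "diff_order n S f" "diff_order n S g"
  shows "diff_order n S (\<lambda>p. (f p, g p))"
  using assms(2,3)
proof (induction n arbitrary: f g)
  case 0
  then show ?case by (simp add: differentiable_Pair)
next
  case (Suc n)
  have "diff_order n S (dir_deriv b (\<lambda>p. (f p, g p)))" if "b \<in> Basis" for b
    using Suc that by (subst diff_order_cong[OF assms(1) dir_deriv_Pair]) auto
  then show ?case using Suc.prems by (simp add: differentiable_Pair)
qed

text \<open>The derivative is the function itself times a derivative of \<open>f\<close>, so the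
  claim at one order feeds the next. The scaling groups need this for smoothness in the group
  parameter.\<close>

lemma diff_order_exp:
  fixes f :: "'a::euclidean_space \<Rightarrow> real"
  assumes "open S" "diff_order n S f"
  shows "diff_order n S (\<lambda>p. exp (f p))"
proof -
  have der: "((\<lambda>p. exp (f p)) has_derivative (\<lambda>h. exp (f p) * dir_deriv h f p)) (at p)"
    if "f differentiable (at p)" for p
    using has_derivative_exp[OF has_derivative_dir_deriv[OF that]] by (simp add: mult.commute)
  show ?thesis using assms(2)
  proof (induction n)
    case 0
    then show ?case using differentiableI[OF der] by auto
  next
    case (Suc n)
    have "diff_order n S (dir_deriv b (\<lambda>p. exp (f p)))" if "b \<in> Basis" for b
      using Suc that diff_order_SucD[OF Suc.prems]
      by (subst diff_order_cong[OF assms(1) dir_deriv_eq[OF der]])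
        (auto intro!: diff_order_mult assms(1))
    then show ?case using Suc.prems differentiableI[OF der] by auto
  qed
qed

lemma diff_order_inverse:
  fixes f :: "'a::euclidean_space \<Rightarrow> real"
  assumes "open S" "diff_order n S f" and nz: "\<And>p. p \<in> S \<Longrightarrow> f p \<noteq> 0"
  shows "diff_order n S (\<lambda>p. inverse (f p))"
proof -
  \<comment> \<open>The sign is written as a constant factor so that the product rule for
    \<open>diff_order\<close> covers the whole expression.\<close>
  have der: "((\<lambda>p. inverse (f p)) has_derivative
      (\<lambda>h. (-1) * (inverse (f p) * dir_deriv h f p * inverse (f p)))) (at p)"
    if "f differentiable (at p)" "p \<in> S" for p
    using Deriv.has_derivative_inverse[OF nz[OF that(2)] has_derivative_dir_deriv[OF that(1)]] by simp
  show ?thesis using assms(2)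
  proof (induction n)
    case 0
    then show ?case using differentiableI[OF der] by auto
  next
    case (Suc n)
    have "diff_order n S (\<lambda>p. -1 :: real)"
      using smooth_on_const smooth_on_iff_diff_order by blast
    moreover have "diff_order n S (\<lambda>p. inverse (f p))"
      by (intro Suc.IH diff_order_SucD[OF Suc.prems])
    ultimately have "diff_order n S (\<lambda>p. (-1) * (inverse (f p) * dir_deriv b f p * inverse (f p)))"
      if "b \<in> Basis" for b
      using Suc.prems that by (intro diff_order_mult assms(1)) simp_all
    then have "diff_order n S (dir_deriv b (\<lambda>p. inverse (f p)))" if "b \<in> Basis" for b
      using Suc.prems that by (subst diff_order_cong[OF assms(1) dir_deriv_eq[OF der]]) simp_all
    then show ?case using Suc.prems differentiableI[OF der] by auto
  qed
qed

lemma smooth_on_add: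
  "open S \<Longrightarrow> smooth_on S f \<Longrightarrow> smooth_on S g \<Longrightarrow> smooth_on S (\<lambda>p. f p + g p)"
  by (simp add: smooth_on_iff_diff_order diff_order_add)

lemma smooth_on_mult:
  fixes f g :: "'a::euclidean_space \<Rightarrow> real"
  shows "open S \<Longrightarrow> smooth_on S f \<Longrightarrow> smooth_on S g \<Longrightarrow> smooth_on S (\<lambda>p. f p * g p)"
  by (simp add: smooth_on_iff_diff_order diff_order_mult)

lemma smooth_on_Pair:
  "open S \<Longrightarrow> smooth_on S f \<Longrightarrow> smooth_on S g \<Longrightarrow> smooth_on S (\<lambda>p. (f p, g p))"
  by (simp add: smooth_on_iff_diff_order diff_order_Pair)

lemma smooth_on_exp:
  fixes f :: "'a::euclidean_space \<Rightarrow> real"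
  shows "open S \<Longrightarrow> smooth_on S f \<Longrightarrow> smooth_on S (\<lambda>p. exp (f p))"
  by (simp add: smooth_on_iff_diff_order diff_order_exp)

lemma smooth_on_minus: "open S \<Longrightarrow> smooth_on S f \<Longrightarrow> smooth_on S (\<lambda>p. - f p)"
  by (intro smooth_on_linear_compose[where L = uminus] bounded_linear_minus bounded_linear_ident)

lemma smooth_on_diff:
  "open S \<Longrightarrow> smooth_on S f \<Longrightarrow> smooth_on S g \<Longrightarrow> smooth_on S (\<lambda>p. f p - g p)"
  using smooth_on_add[of S f "\<lambda>p. - g p"] smooth_on_minus[of S g] by simp

lemma smooth_on_divide:
  fixes f g :: "'a::euclidean_space \<Rightarrow> real"
  shows "open S \<Longrightarrow> smooth_on S f \<Longrightarrow> smooth_on S g \<Longrightarrow> (\<And>p. p \<in> S \<Longrightarrow> g p \<noteq> 0)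
    \<Longrightarrow> smooth_on S (\<lambda>p. f p / g p)"
  by (simp add: smooth_on_iff_diff_order diff_order_mult diff_order_inverse divide_inverse)

lemma smooth_on_power:
  fixes f :: "'a::euclidean_space \<Rightarrow> real"
  shows "open S \<Longrightarrow> smooth_on S f \<Longrightarrow> smooth_on S (\<lambda>p. f p ^ n)"
  by (induction n) (auto intro: smooth_on_mult)

lemmas smooth_on_intros =
  smooth_on_const smooth_on_add smooth_on_diff smooth_on_minus smooth_on_mult smooth_on_divide
  smooth_on_power smooth_on_exp smooth_on_Pair

subsection \<open>Growth of nets of smooth functions\<close>

text \<open>The cones \<open>{C / \<epsilon> ^ N}\<close> and, for fixed \<open>m\<close>, \<open>{C * \<epsilon> ^ m}\<close> let moderateness and
  negligibility be treated alike.\<close>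

definition growth_cone :: "(real \<Rightarrow> real) set \<Rightarrow> bool" where
  "growth_cone E \<longleftrightarrow> E \<noteq> {} \<and>
     (\<forall>e\<in>E. \<forall>e'\<in>E. \<exists>e''\<in>E. \<forall>\<^sub>F \<epsilon> in at_right 0. e \<epsilon> + e' \<epsilon> \<le> e'' \<epsilon>) \<and>
     (\<forall>e\<in>E. \<forall>c\<ge>0. \<exists>e'\<in>E. \<forall>\<^sub>F \<epsilon> in at_right 0. c * e \<epsilon> \<le> e' \<epsilon>)"

definition dominated ::
  "(real \<Rightarrow> real) set \<Rightarrow> 'a set \<Rightarrow> (real \<Rightarrow> 'a \<Rightarrow> real) \<Rightarrow> bool" where
  "dominated E K f \<longleftrightarrow> (\<exists>e\<in>E. \<forall>\<^sub>F \<epsilon> in at_right 0. \<forall>p\<in>K. \<bar>f \<epsilon> p\<bar> \<le> e \<epsilon>)"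

lemma eventually_unit_interval: "\<forall>\<^sub>F \<epsilon> in at_right (0::real). \<epsilon> \<in> {0<..1}"
  by (rule eventually_at_rightI[of _ 1]) auto

lemma dominated_zero: "growth_cone E \<Longrightarrow> dominated E K (\<lambda>\<epsilon> p. 0)"
proof -
  assume E: "growth_cone E"
  then obtain e where "e \<in> E" unfolding growth_cone_def by blast
  \<comment> \<open>A member of the cone may be negative, as its constant may be; scaling by 0
    yields one that is eventually nonnegative.\<close>
  then obtain e' where "e' \<in> E" "\<forall>\<^sub>F \<epsilon> in at_right 0. 0 * e \<epsilon> \<le> e' \<epsilon>"
    using E unfolding growth_cone_def by (meson order_refl)
  then show ?thesis by (auto simp: dominated_def)
qed

lemma dominated_cong:
  assumes "\<And>\<epsilon> p. \<epsilon> \<in> {0<..1} \<Longrightarrow> p \<in> K \<Longrightarrow> f \<epsilon> p = g \<epsilon> p"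
  shows "dominated E K f \<longleftrightarrow> dominated E K g"
proof -
  have "dominated E K g" if "dominated E K f"
    and "\<And>\<epsilon> p. \<epsilon> \<in> {0<..1} \<Longrightarrow> p \<in> K \<Longrightarrow> f \<epsilon> p = g \<epsilon> p" for f g :: "real \<Rightarrow> 'a \<Rightarrow> real"
  proof -
    from that(1) obtain e where "e \<in> E" "\<forall>\<^sub>F \<epsilon> in at_right 0. \<forall>p\<in>K. \<bar>f \<epsilon> p\<bar> \<le> e \<epsilon>"
      by (auto simp: dominated_def)
    moreover from this(2) eventually_unit_interval
    have "\<forall>\<^sub>F \<epsilon> in at_right 0. \<forall>p\<in>K. \<bar>g \<epsilon> p\<bar> \<le> e \<epsilon>"
      by eventually_elim (use that(2) in auto)
    ultimately show ?thesis by (auto simp: dominated_def)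
  qed
  from this[of f g] this[of g f] assms[symmetric] assms show ?thesis by blast
qed

lemma dominated_add:
  assumes "growth_cone E" "dominated E K f" "dominated E K g"
  shows "dominated E K (\<lambda>\<epsilon> p. f \<epsilon> p + g \<epsilon> p)"
proof -
  obtain e e' where e: "e \<in> E" "\<forall>\<^sub>F \<epsilon> in at_right 0. \<forall>p\<in>K. \<bar>f \<epsilon> p\<bar> \<le> e \<epsilon>"
    and e': "e' \<in> E" "\<forall>\<^sub>F \<epsilon> in at_right 0. \<forall>p\<in>K. \<bar>g \<epsilon> p\<bar> \<le> e' \<epsilon>"
    using assms(2,3) by (auto simp: dominated_def)
  obtain e'' where e'': "e'' \<in> E" "\<forall>\<^sub>F \<epsilon> in at_right 0. e \<epsilon> + e' \<epsilon> \<le> e'' \<epsilon>"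
    using assms(1) e(1) e'(1) unfolding growth_cone_def by blast
  have "\<forall>\<^sub>F \<epsilon> in at_right 0. \<forall>p\<in>K. \<bar>f \<epsilon> p + g \<epsilon> p\<bar> \<le> e'' \<epsilon>"
    using e(2) e'(2) e''(2) by eventually_elim force
  with e'' show ?thesis by (auto simp: dominated_def)
qed

lemma dominated_pullback:
  assumes "growth_cone E" "dominated E (\<Theta> ` K) f" "\<And>p. p \<in> K \<Longrightarrow> \<bar>\<kappa> p\<bar> \<le> c"
  shows "dominated E K (\<lambda>\<epsilon> p. \<kappa> p * f \<epsilon> (\<Theta> p))"
proof -
  obtain e where e: "e \<in> E" "\<forall>\<^sub>F \<epsilon> in at_right 0. \<forall>p\<in>\<Theta> ` K. \<bar>f \<epsilon> p\<bar> \<le> e \<epsilon>"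
    using assms(2) by (auto simp: dominated_def)
  \<comment> \<open>If \<open>K\<close> is empty, \<open>c\<close> can be negative, but cones are
    closed under nonnegative factors only.\<close>
  have "0 \<le> \<bar>c\<bar>" by simp
  then obtain e' where e': "e' \<in> E" "\<forall>\<^sub>F \<epsilon> in at_right 0. \<bar>c\<bar> * e \<epsilon> \<le> e' \<epsilon>"
    using assms(1) e(1) unfolding growth_cone_def by blast
  have "\<forall>\<^sub>F \<epsilon> in at_right 0. \<forall>p\<in>K. \<bar>\<kappa> p * f \<epsilon> (\<Theta> p)\<bar> \<le> e' \<epsilon>"
    using e(2) e'(2)
  proof eventually_elim
    case (elim \<epsilon>)
    have "\<bar>\<kappa> p * f \<epsilon> (\<Theta> p)\<bar> \<le> \<bar>c\<bar> * e \<epsilon>" if "p \<in> K" for p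
      unfolding abs_mult using assms(3)[OF that] elim(1) that by (intro mult_mono) auto
    with elim(2) show ?case by force
  qed
  with e' show ?thesis by (auto simp: dominated_def)
qed

section \<open>Nets with all derivatives bounded up to a given order\<close>

text \<open>The counterpart of \<open>diff_order\<close> for nets, with the bounds on compact sets
  carried along. The bounding function may change with the compact set and the derivative, as in the
  definitions of moderate and negligible nets.\<close>

primrec net_order ::
  "(real \<Rightarrow> real) set \<Rightarrow> nat \<Rightarrow> 'a::euclidean_space set \<Rightarrow> (real \<Rightarrow> 'a \<Rightarrow> real) \<Rightarrow> bool" where
  "net_order E 0 S f \<longleftrightarrow> (\<forall>\<epsilon>\<in>{0<..1}. \<forall>p\<in>S. f \<epsilon> differentiable (at p)) \<and>
     (\<forall>K. compact K \<longrightarrow> K \<subseteq> S \<longrightarrow> dominated E K f)"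
| "net_order E (Suc n) S f \<longleftrightarrow> (\<forall>\<epsilon>\<in>{0<..1}. \<forall>p\<in>S. f \<epsilon> differentiable (at p)) \<and>
     (\<forall>K. compact K \<longrightarrow> K \<subseteq> S \<longrightarrow> dominated E K f) \<and>
     (\<forall>b\<in>Basis. net_order E n S (\<lambda>\<epsilon>. dir_deriv b (f \<epsilon>)))"

lemma net_order_0: "net_order E n S f \<Longrightarrow> net_order E 0 S f"
  by (cases n) auto

lemma net_order_SucD: "net_order E (Suc n) S f \<Longrightarrow> net_order E n S f"
  by (induction n arbitrary: f) auto

lemma net_order_iter_deriv:
  "bs \<in> lists Basis \<Longrightarrow> net_order E (length bs) S f
    \<Longrightarrow> net_order E 0 S (\<lambda>\<epsilon>. iter_deriv bs (f \<epsilon>))"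
  by (induction bs arbitrary: f) (simp_all del: net_order.simps(1))

lemma net_orderI:
  assumes "\<And>\<epsilon>. \<epsilon> \<in> {0<..1} \<Longrightarrow> smooth_on S (f \<epsilon>)"
    and "\<And>K bs. compact K \<Longrightarrow> K \<subseteq> S \<Longrightarrow> bs \<in> lists Basis
      \<Longrightarrow> dominated E K (\<lambda>\<epsilon>. iter_deriv bs (f \<epsilon>))"
  shows "net_order E n S f"
  using assms
proof (induction n arbitrary: f)
  case 0
  have "\<forall>\<epsilon>\<in>{0<..1}. \<forall>p\<in>S. f \<epsilon> differentiable (at p)"
    using 0(1) by (blast intro: smooth_on_differentiable)
  then show ?case using 0(2)[of _ "[]"] by simp
next
  case (Suc n)
  have "net_order E n S (\<lambda>\<epsilon>. dir_deriv b (f \<epsilon>))" if b: "b \<in> Basis" for b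
  proof (rule Suc.IH)
    show "dominated E K (\<lambda>\<epsilon>. iter_deriv bs (dir_deriv b (f \<epsilon>)))"
      if "compact K" "K \<subseteq> S" "bs \<in> lists Basis" for K bs
      using Suc.prems(2)[OF that(1,2), of "b # bs"] that(3) b by simp
  qed (rule smooth_on_dir_deriv[OF Suc.prems(1) b])
  moreover have "\<forall>\<epsilon>\<in>{0<..1}. \<forall>p\<in>S. f \<epsilon> differentiable (at p)"
    using Suc.prems(1) by (blast intro: smooth_on_differentiable)
  ultimately show ?case using Suc.prems(2)[of _ "[]"] by simp
qed

lemma all_net_order_iff:
  "(\<forall>n. net_order E n S f) \<longleftrightarrow> (\<forall>\<epsilon>\<in>{0<..1}. smooth_on S (f \<epsilon>)) \<and>
     (\<forall>K bs. compact K \<longrightarrow> K \<subseteq> S \<longrightarrow> bs \<in> lists Basis \<longrightarrow> dominated E K (\<lambda>\<epsilon>. iter_deriv bs (f \<epsilon>)))"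
  (is "?L \<longleftrightarrow> ?R")
proof
  assume ?L
  then have *: "net_order E 0 S (\<lambda>\<epsilon>. iter_deriv bs (f \<epsilon>))" if "bs \<in> lists Basis" for bs
    using net_order_iter_deriv[OF that] by blast
  show ?R
    unfolding smooth_on_def using * unfolding net_order.simps(1) by blast
next
  assume ?R
  then show ?L by (intro allI net_orderI) blast+
qed

lemma net_order_cong:
  assumes "open S" "\<And>\<epsilon> p. \<epsilon> \<in> {0<..1} \<Longrightarrow> p \<in> S \<Longrightarrow> f \<epsilon> p = g \<epsilon> p"
  shows "net_order E n S f \<longleftrightarrow> net_order E n S g"
  using assms(2)
proof (induction n arbitrary: f g)
  case 0
  have "(\<forall>p\<in>S. f \<epsilon> differentiable (at p)) \<longleftrightarrow> (\<forall>p\<in>S. g \<epsilon> differentiable (at p))" if "\<epsilon> \<in> {0<..1}" for \<epsilon>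
    using differentiable_cong_open[OF assms(1), of _ "f \<epsilon>" "g \<epsilon>"] 0[OF that] by blast
  moreover have "dominated E K f \<longleftrightarrow> dominated E K g" if "K \<subseteq> S" for K
    by (rule dominated_cong) (use 0 that in auto)
  ultimately show ?case by simp
next
  case (Suc n)
  have "(\<forall>p\<in>S. f \<epsilon> differentiable (at p)) \<longleftrightarrow> (\<forall>p\<in>S. g \<epsilon> differentiable (at p))" if "\<epsilon> \<in> {0<..1}" for \<epsilon>
    using differentiable_cong_open[OF assms(1), of _ "f \<epsilon>" "g \<epsilon>"] Suc.prems[OF that] by blast
  moreover have "dominated E K f \<longleftrightarrow> dominated E K g" if "K \<subseteq> S" for K
    by (rule dominated_cong) (use Suc.prems that in auto)
  moreover have "net_order E n S (\<lambda>\<epsilon>. dir_deriv b (f \<epsilon>)) \<longleftrightarrow> net_order E n S (\<lambda>\<epsilon>. dir_deriv b (g \<epsilon>))" for b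
    by (intro Suc.IH dir_deriv_cong_open[OF assms(1)] Suc.prems)
  ultimately show ?case by simp
qed

lemma net_order_add:
  assumes "open S" "growth_cone E" "net_order E n S f" "net_order E n S g"
  shows "net_order E n S (\<lambda>\<epsilon> p. f \<epsilon> p + g \<epsilon> p)"
  using assms(3,4)
proof (induction n arbitrary: f g)
  case 0
  then show ?case by (auto intro: dominated_add assms)
next
  case (Suc n)
  have "net_order E n S (\<lambda>\<epsilon>. dir_deriv b (\<lambda>p. f \<epsilon> p + g \<epsilon> p))" if b: "b \<in> Basis" for b
  proof -
    have "net_order E n S (\<lambda>\<epsilon> p. dir_deriv b (f \<epsilon>) p + dir_deriv b (g \<epsilon>) p)"
      using Suc b by auto
    then show ?thesis
      by (subst net_order_cong[OF assms(1) dir_deriv_add]) (use Suc.prems in auto)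
  qed
  then show ?case using Suc.prems by (auto intro: dominated_add assms)
qed

lemma net_order_zero:
  assumes "growth_cone E"
  shows "net_order E n S (\<lambda>\<epsilon> p. 0)"
  by (induction n) (simp_all add: dominated_zero[OF assms])

lemma net_order_sum:
  assumes "open S" "growth_cone E" "finite I" "\<And>i. i \<in> I \<Longrightarrow> net_order E n S (f i)"
  shows "net_order E n S (\<lambda>\<epsilon> p. \<Sum>i\<in>I. f i \<epsilon> p)"
  using assms(3,4)
proof (induction I rule: finite_induct)
  case empty
  then show ?case by (simp add: net_order_zero[OF assms(2)])
next
  case (insert i I)
  then have "net_order E n S (\<lambda>\<epsilon> p. f i \<epsilon> p + (\<Sum>i\<in>I. f i \<epsilon> p))"
    by (intro net_order_add assms(1,2)) simp_all
  with insert.hyps show ?case by simp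
qed

lemma net_order_pullback:
  assumes "open S'" "growth_cone E" "\<Theta> ` S' \<subseteq> S" "smooth_on S' \<Theta>" "smooth_on S' \<kappa>" "net_order E n S f"
  shows "net_order E n S' (\<lambda>\<epsilon> p. \<kappa> p * f \<epsilon> (\<Theta> p))"
  using assms(5,6)
proof (induction n arbitrary: \<kappa> f)
  \<comment> \<open>Kept general in \<kappa> and \<open>f\<close>, because the inductive step also
    has to supply differentiability and bounds for the undifferentiated product.\<close>
  have base: "net_order E 0 S' (\<lambda>\<epsilon> p. \<kappa> p * f \<epsilon> (\<Theta> p))" if "smooth_on S' \<kappa>" "net_order E 0 S f" for \<kappa> f
    unfolding net_order.simps
  proof (intro conjI ballI allI impI)
    show "(\<lambda>p. \<kappa> p * f \<epsilon> (\<Theta> p)) differentiable at p" if "\<epsilon> \<in> {0<..1}" "p \<in> S'" for \<epsilon> p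
    proof (rule differentiable_mult)
      show "\<kappa> differentiable at p"
        using \<open>smooth_on S' \<kappa>\<close> that smooth_on_differentiable by blast
      have "\<Theta> p \<in> S" "\<Theta> differentiable at p"
        using that assms(3,4) by (auto intro: smooth_on_differentiable)
      moreover from this have "f \<epsilon> differentiable at (\<Theta> p)"
        using \<open>net_order E 0 S f\<close> that(1) by simp
      ultimately show "(\<lambda>p. f \<epsilon> (\<Theta> p)) differentiable at p"
        using differentiableI has_derivative_compose_dir_deriv by blast
    qed
    fix K assume K: "compact K" "K \<subseteq> S'"
    then have "continuous_on K \<Theta>" "continuous_on K \<kappa>"
      using assms(4) that(1) by (meson smooth_on_continuous continuous_on_subset)+
    then have "compact (\<Theta> ` K)" "bounded (\<kappa> ` K)"
      using K by (meson compact_continuous_image compact_imp_bounded)+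
    moreover from this(2) obtain c where "\<And>p. p \<in> K \<Longrightarrow> \<bar>\<kappa> p\<bar> \<le> c"
      by (auto simp: bounded_iff)
    moreover have "\<Theta> ` K \<subseteq> S" using K assms(3) by blast
    ultimately show "dominated E K (\<lambda>\<epsilon> p. \<kappa> p * f \<epsilon> (\<Theta> p))"
      using that(2) by (intro dominated_pullback[OF assms(2)]) auto
  qed
  {
    case 0
    then show ?case by (rule base)
  next
    case (Suc n)
    note sm = Suc.prems(1) and net = Suc.prems(2)
    have "net_order E n S' (\<lambda>\<epsilon>. dir_deriv b (\<lambda>p. \<kappa> p * f \<epsilon> (\<Theta> p)))" if b: "b \<in> Basis" for b
    proof -
      have eq: "dir_deriv b (\<lambda>p. \<kappa> p * f \<epsilon> (\<Theta> p)) p = dir_deriv b \<kappa> p * f \<epsilon> (\<Theta> p) +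
          (\<Sum>c\<in>Basis. \<kappa> p * (dir_deriv b \<Theta> p \<bullet> c) * dir_deriv c (f \<epsilon>) (\<Theta> p))"
        if "\<epsilon> \<in> {0<..1}" "p \<in> S'" for \<epsilon> p
      proof -
        have d: "\<kappa> differentiable at p" "\<Theta> differentiable at p" "f \<epsilon> differentiable at (\<Theta> p)"
          using that assms(3,4) sm net by (auto intro: smooth_on_differentiable)
        show ?thesis
          unfolding dir_deriv_mult[OF d(1) differentiableI[OF has_derivative_compose_dir_deriv[OF d(2,3)]]]
            dir_deriv_compose[OF d(2,3)]
          by (subst dir_deriv_components[OF d(3)]) (simp add: sum_distrib_left mult.assoc)
      qed
      have "net_order E n S' (\<lambda>\<epsilon> p. \<kappa> p * (dir_deriv b \<Theta> p \<bullet> c) * dir_deriv c (f \<epsilon>) (\<Theta> p))"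
        if "c \<in> Basis" for c
      proof (rule Suc.IH)
        show "smooth_on S' (\<lambda>p. \<kappa> p * (dir_deriv b \<Theta> p \<bullet> c))"
          using assms(1,4) sm b by (intro smooth_on_mult smooth_on_linear_compose[where L = "\<lambda>x. x \<bullet> c"]
              bounded_linear_inner_left smooth_on_dir_deriv)
        show "net_order E n S (\<lambda>\<epsilon>. dir_deriv c (f \<epsilon>))" using net that by simp
      qed
      moreover have "net_order E n S' (\<lambda>\<epsilon> p. dir_deriv b \<kappa> p * f \<epsilon> (\<Theta> p))"
        using net net_order_SucD b sm by (intro Suc.IH smooth_on_dir_deriv) blast+
      ultimately have "net_order E n S' (\<lambda>\<epsilon> p. dir_deriv b \<kappa> p * f \<epsilon> (\<Theta> p) +
          (\<Sum>c\<in>Basis. \<kappa> p * (dir_deriv b \<Theta> p \<bullet> c) * dir_deriv c (f \<epsilon>) (\<Theta> p)))"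
        by (intro net_order_add net_order_sum assms(1,2) finite_Basis)
      with net_order_cong[OF assms(1) eq] show ?thesis by presburger
    qed
    then show ?case using base[OF sm net_order_0[OF net]] by simp
  }
qed

subsection \<open>The Colombeau algebra\<close>

definition moderate_cone :: "(real \<Rightarrow> real) set" where
  "moderate_cone = (\<Union>N. range (\<lambda>C \<epsilon>. C / \<epsilon> ^ N))"

definition negligible_cone :: "nat \<Rightarrow> (real \<Rightarrow> real) set" where
  "negligible_cone m = range (\<lambda>C \<epsilon>. C * \<epsilon> ^ m)"

lemma dominated_moderate_cone:
  "dominated moderate_cone K f \<longleftrightarrow>
     (\<exists>N C. \<forall>\<^sub>F \<epsilon> in at_right 0. \<forall>p\<in>K. \<bar>f \<epsilon> p\<bar> \<le> C / \<epsilon> ^ N)"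
  by (simp add: dominated_def moderate_cone_def)

lemma dominated_negligible_cone:
  "dominated (negligible_cone m) K f \<longleftrightarrow>
     (\<exists>C. \<forall>\<^sub>F \<epsilon> in at_right 0. \<forall>p\<in>K. \<bar>f \<epsilon> p\<bar> \<le> C * \<epsilon> ^ m)"
  by (simp add: dominated_def negligible_cone_def)

lemma growth_cone_moderate: "growth_cone moderate_cone"
  unfolding growth_cone_def
proof (intro conjI ballI allI impI)
  show "moderate_cone \<noteq> {}" by (auto simp: moderate_cone_def)
  fix e assume "e \<in> moderate_cone"
  then obtain C N where e: "e = (\<lambda>\<epsilon>. C / \<epsilon> ^ N)" by (auto simp: moderate_cone_def)
  { fix e' assume "e' \<in> moderate_cone"
    then obtain C' N' where e': "e' = (\<lambda>\<epsilon>. C' / \<epsilon> ^ N')" by (auto simp: moderate_cone_def)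
    \<comment> \<open>For \<epsilon> at most 1 a larger exponent weakens the bound, provided the
      constants are made nonnegative.\<close>
    have "e \<epsilon> + e' \<epsilon> \<le> (\<bar>C\<bar> + \<bar>C'\<bar>) / \<epsilon> ^ (N + N')" if "\<epsilon> \<in> {0<..1}" for \<epsilon>
    proof -
      have "C / \<epsilon> ^ N \<le> \<bar>C\<bar> / \<epsilon> ^ (N + N')" "C' / \<epsilon> ^ N' \<le> \<bar>C'\<bar> / \<epsilon> ^ (N + N')"
        using that by (auto intro!: frac_le power_decreasing)
      then show ?thesis by (simp add: e e' add_divide_distrib)
    qed
    then have "\<forall>\<^sub>F \<epsilon> in at_right 0. e \<epsilon> + e' \<epsilon> \<le> (\<bar>C\<bar> + \<bar>C'\<bar>) / \<epsilon> ^ (N + N')"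
      using eventually_unit_interval by (rule eventually_mono[rotated])
    then show "\<exists>e''\<in>moderate_cone. \<forall>\<^sub>F \<epsilon> in at_right 0. e \<epsilon> + e' \<epsilon> \<le> e'' \<epsilon>"
      by (intro bexI[of _ "\<lambda>\<epsilon>. (\<bar>C\<bar> + \<bar>C'\<bar>) / \<epsilon> ^ (N + N')"]) (auto simp: moderate_cone_def) }
  fix c :: real
  show "\<exists>e'\<in>moderate_cone. \<forall>\<^sub>F \<epsilon> in at_right 0. c * e \<epsilon> \<le> e' \<epsilon>"
    by (intro bexI[of _ "\<lambda>\<epsilon>. (c * C) / \<epsilon> ^ N"]) (auto simp: moderate_cone_def e)
qed

lemma growth_cone_negligible: "growth_cone (negligible_cone m)"
  unfolding growth_cone_def
proof (intro conjI ballI allI impI)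
  show "negligible_cone m \<noteq> {}" by (auto simp: negligible_cone_def)
  fix e assume "e \<in> negligible_cone m"
  then obtain C where e: "e = (\<lambda>\<epsilon>. C * \<epsilon> ^ m)" by (auto simp: negligible_cone_def)
  { fix e' assume "e' \<in> negligible_cone m"
    then obtain C' where e': "e' = (\<lambda>\<epsilon>. C' * \<epsilon> ^ m)" by (auto simp: negligible_cone_def)
    show "\<exists>e''\<in>negligible_cone m. \<forall>\<^sub>F \<epsilon> in at_right 0. e \<epsilon> + e' \<epsilon> \<le> e'' \<epsilon>"
      by (rule bexI[of _ "\<lambda>\<epsilon>. (C + C') * \<epsilon> ^ m"])
        (simp add: e e' distrib_right, simp add: negligible_cone_def) }
  fix c :: real
  show "\<exists>e'\<in>negligible_cone m. \<forall>\<^sub>F \<epsilon> in at_right 0. c * e \<epsilon> \<le> e' \<epsilon>"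
    by (intro bexI[of _ "\<lambda>\<epsilon>. (c * C) * \<epsilon> ^ m"]) (auto simp: negligible_cone_def e)
qed

lemma moderate_nets_iff: "u \<in> moderate_nets \<Omega> \<longleftrightarrow> (\<forall>n. net_order moderate_cone n \<Omega> u)"
  unfolding all_net_order_iff dominated_moderate_cone moderate_nets_def mem_Collect_eq ..

lemma negligible_nets_iff:
  "u \<in> negligible_nets \<Omega> \<longleftrightarrow>
     u \<in> moderate_nets \<Omega> \<and> (\<forall>m n. net_order (negligible_cone m) n \<Omega> u)"
proof -
  have "\<forall>\<epsilon>\<in>{0<..1}. smooth_on \<Omega> (u \<epsilon>)" if "u \<in> moderate_nets \<Omega>"
    using that by (simp add: moderate_nets_def)
  then show ?thesis
    unfolding all_net_order_iff dominated_negligible_cone negligible_nets_def mem_Collect_eq by blast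
qed

lemma moderate_nets_smooth: "u \<in> moderate_nets \<Omega> \<Longrightarrow> \<epsilon> \<in> {0<..1} \<Longrightarrow> smooth_on \<Omega> (u \<epsilon>)"
  by (simp add: moderate_nets_def)

lemma moderate_nets_cong:
  assumes "open \<Omega>" "\<And>\<epsilon> p. p \<in> \<Omega> \<Longrightarrow> u \<epsilon> p = w \<epsilon> p"
  shows "u \<in> moderate_nets \<Omega> \<longleftrightarrow> w \<in> moderate_nets \<Omega>"
  using net_order_cong[OF assms(1), of u w] assms(2) unfolding moderate_nets_iff by simp

lemma negligible_nets_cong:
  assumes "open \<Omega>" "\<And>\<epsilon> p. p \<in> \<Omega> \<Longrightarrow> u \<epsilon> p = w \<epsilon> p"
  shows "u \<in> negligible_nets \<Omega> \<longleftrightarrow> w \<in> negligible_nets \<Omega>"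
  using net_order_cong[OF assms(1), of u w] moderate_nets_cong[OF assms] assms(2)
  unfolding negligible_nets_iff by simp

lemma moderate_nets_add:
  "open \<Omega> \<Longrightarrow> u \<in> moderate_nets \<Omega> \<Longrightarrow> w \<in> moderate_nets \<Omega>
    \<Longrightarrow> (\<lambda>\<epsilon> p. u \<epsilon> p + w \<epsilon> p) \<in> moderate_nets \<Omega>"
  unfolding moderate_nets_iff by (blast intro: net_order_add growth_cone_moderate)

lemma negligible_nets_add:
  "open \<Omega> \<Longrightarrow> u \<in> negligible_nets \<Omega> \<Longrightarrow> w \<in> negligible_nets \<Omega>
    \<Longrightarrow> (\<lambda>\<epsilon> p. u \<epsilon> p + w \<epsilon> p) \<in> negligible_nets \<Omega>"
  unfolding negligible_nets_iff
  by (blast intro: net_order_add growth_cone_negligible moderate_nets_add)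

lemma zero_negligible: "(\<lambda>\<epsilon> p. 0) \<in> negligible_nets \<Omega>"
  unfolding negligible_nets_iff moderate_nets_iff
  by (blast intro: net_order_zero growth_cone_negligible growth_cone_moderate)

lemma moderate_nets_pullback:
  assumes "open S'" "\<Theta> ` S' \<subseteq> S" "smooth_on S' \<Theta>" "smooth_on S' \<kappa>" "u \<in> moderate_nets S"
  shows "(\<lambda>\<epsilon> p. \<kappa> p * u \<epsilon> (\<Theta> p)) \<in> moderate_nets S'"
  using assms(5) net_order_pullback[OF assms(1) growth_cone_moderate assms(2-4)]
  unfolding moderate_nets_iff by blast

lemma negligible_nets_pullback:
  assumes "open S'" "\<Theta> ` S' \<subseteq> S" "smooth_on S' \<Theta>" "smooth_on S' \<kappa>" "u \<in> negligible_nets S"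
  shows "(\<lambda>\<epsilon> p. \<kappa> p * u \<epsilon> (\<Theta> p)) \<in> negligible_nets S'"
  using assms(5) net_order_pullback[OF assms(1) growth_cone_negligible assms(2-4)]
    moderate_nets_pullback[OF assms(1-4)]
  unfolding negligible_nets_iff by blast

lemma smooth_on_iter_deriv: "smooth_on S f \<Longrightarrow> bs \<in> lists Basis \<Longrightarrow> smooth_on S (iter_deriv bs f)"
  by (induction bs arbitrary: f) (auto intro: smooth_on_dir_deriv)

text \<open>Compactness bounds each derivative, so the exponent 0 suffices. It handles the
  inhomogeneous term of an affine action and lets results on nets be applied to single
  functions.\<close>

lemma smooth_moderate:
  assumes "smooth_on \<Omega> g"
  shows "(\<lambda>\<epsilon>. g) \<in> moderate_nets \<Omega>"
  unfolding moderate_nets_iff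
proof (intro allI net_orderI)
  fix K bs assume K: "compact K" "K \<subseteq> \<Omega>" and bs: "bs \<in> lists (Basis :: point set)"
  have "continuous_on K (iter_deriv bs g)"
    using smooth_on_continuous[OF smooth_on_iter_deriv[OF assms bs]] K(2) continuous_on_subset by blast
  then have "bounded (iter_deriv bs g ` K)"
    using K(1) by (meson compact_continuous_image compact_imp_bounded)
  then obtain C where "\<forall>p\<in>K. \<bar>iter_deriv bs g p\<bar> \<le> C"
    by (auto simp: bounded_iff)
  then have "\<forall>\<^sub>F \<epsilon> in at_right 0. \<forall>p\<in>K. \<bar>iter_deriv bs g p\<bar> \<le> C / \<epsilon> ^ 0"
    by simp
  then show "dominated moderate_cone K (\<lambda>\<epsilon>. iter_deriv bs g)"
    unfolding dominated_moderate_cone by blast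
qed (rule assms)

lemma equiv_colombeau_rel:
  assumes "open \<Omega>"
  shows "equiv (moderate_nets \<Omega>) (colombeau_rel \<Omega>)"
proof (rule equivI)
  show "colombeau_rel \<Omega> \<subseteq> moderate_nets \<Omega> \<times> moderate_nets \<Omega>"
    by (auto simp: colombeau_rel_def)
  show "refl_on (moderate_nets \<Omega>) (colombeau_rel \<Omega>)"
    using zero_negligible by (auto simp: refl_on_def colombeau_rel_def)
  have "(\<lambda>\<epsilon> p. w \<epsilon> p - u \<epsilon> p) \<in> negligible_nets \<Omega>"
    if "(\<lambda>\<epsilon> p. u \<epsilon> p - w \<epsilon> p) \<in> negligible_nets \<Omega>" for u w
    \<comment> \<open>Negation is a pullback along the identity with multiplier -1.\<close>
    using negligible_nets_pullback[OF assms _ smooth_on_linear[OF bounded_linear_ident]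
        smooth_on_const[of _ "-1"] that] by simp
  then show "sym (colombeau_rel \<Omega>)"
    by (auto simp: sym_def colombeau_rel_def)
  have "(\<lambda>\<epsilon> p. u \<epsilon> p - w \<epsilon> p + (w \<epsilon> p - z \<epsilon> p)) \<in> negligible_nets \<Omega>"
    if "(\<lambda>\<epsilon> p. u \<epsilon> p - w \<epsilon> p) \<in> negligible_nets \<Omega>" "(\<lambda>\<epsilon> p. w \<epsilon> p - z \<epsilon> p) \<in> negligible_nets \<Omega>" for u w z
    by (rule negligible_nets_add[OF assms that])
  then show "trans (colombeau_rel \<Omega>)"
    by (auto simp: trans_def colombeau_rel_def)
qed

section \<open>Affine actions on classes of nets\<close>

text \<open>In a difference of two values of \<open>F\<close> the term
  \<open>\<kappa>\<^sub>0\<close> cancels, and what remains is linear in the differences of the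
  representatives, with smooth coefficients. Equivalent representatives therefore give equivalent
  values, and all classes in the union coincide.\<close>

lemma affine_pullback_colombeau:
  assumes "open \<Omega>" "open \<Omega>'" "\<Theta> ` \<Omega>' \<subseteq> \<Omega>" "smooth_on \<Omega>' \<Theta>"
    and "smooth_on \<Omega>' \<kappa>\<^sub>0" "smooth_on \<Omega>' \<kappa>\<^sub>1" "smooth_on \<Omega>' \<kappa>\<^sub>2"
    and U: "U \<in> colombeau \<Omega>" and V: "V \<in> colombeau \<Omega>"
    and F: "\<And>u v \<epsilon> p. p \<in> \<Omega>' \<Longrightarrow> F u v \<epsilon> p = \<kappa>\<^sub>0 p + (\<kappa>\<^sub>1 p * u \<epsilon> (\<Theta> p) + \<kappa>\<^sub>2 p * v \<epsilon> (\<Theta> p))"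
  shows "(\<Union>u\<in>U. \<Union>v\<in>V. colombeau_rel \<Omega>' `` {F u v}) \<in> colombeau \<Omega>'"
    and "u \<in> U \<Longrightarrow> v \<in> V \<Longrightarrow> F u v \<in> (\<Union>u\<in>U. \<Union>v\<in>V. colombeau_rel \<Omega>' `` {F u v})"
proof -
  note E = equiv_colombeau_rel[OF assms(1)] and E' = equiv_colombeau_rel[OF assms(2)]
  have mod: "u \<in> moderate_nets \<Omega>" if "u \<in> W" "W \<in> colombeau \<Omega>" for u W
    using that in_quotient_imp_subset[OF E] by (auto simp: colombeau_def)
  have rel: "(u, w) \<in> colombeau_rel \<Omega>" if "u \<in> W" "w \<in> W" "W \<in> colombeau \<Omega>" for u w W
    using that in_quotient_imp_in_rel[OF E] by (auto simp: colombeau_def)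
  have F_mod: "F u v \<in> moderate_nets \<Omega>'" if "u \<in> U" "v \<in> V" for u v
    by (subst moderate_nets_cong[OF assms(2) F], assumption)
      (intro moderate_nets_add moderate_nets_pullback[of _ _ \<Omega>] assms smooth_moderate mod[OF that(1) U] mod[OF that(2) V])
  have F_rel: "(F u v, F u' v') \<in> colombeau_rel \<Omega>'"
    if "u \<in> U" "u' \<in> U" "v \<in> V" "v' \<in> V" for u u' v v'
  proof -
    have "(\<lambda>\<epsilon> p. u \<epsilon> p - u' \<epsilon> p) \<in> negligible_nets \<Omega>" "(\<lambda>\<epsilon> p. v \<epsilon> p - v' \<epsilon> p) \<in> negligible_nets \<Omega>"
      using rel[OF that(1,2) U] rel[OF that(3,4) V] by (simp_all add: colombeau_rel_def)
    then have "(\<lambda>\<epsilon> p. \<kappa>\<^sub>1 p * (u \<epsilon> (\<Theta> p) - u' \<epsilon> (\<Theta> p)) + \<kappa>\<^sub>2 p * (v \<epsilon> (\<Theta> p) - v' \<epsilon> (\<Theta> p)))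
        \<in> negligible_nets \<Omega>'"
      by (intro negligible_nets_add negligible_nets_pullback[OF assms(2-4,6)]
          negligible_nets_pullback[OF assms(2-4,7)] assms(2))
    then have "(\<lambda>\<epsilon> p. F u v \<epsilon> p - F u' v' \<epsilon> p) \<in> negligible_nets \<Omega>'"
      by (subst negligible_nets_cong[OF assms(2)]) (simp_all add: F algebra_simps)
    then show ?thesis using F_mod that by (simp add: colombeau_rel_def)
  qed
  show mem: "F u v \<in> (\<Union>u\<in>U. \<Union>v\<in>V. colombeau_rel \<Omega>' `` {F u v})" if "u \<in> U" "v \<in> V" for u v
    using F_rel that by blast
  \<comment> \<open>Classes are nonempty, so the union is not empty and collapses to the class of
    this one value.\<close>
  obtain u v where uv: "u \<in> U" "v \<in> V"
    using U V in_quotient_imp_non_empty[OF E] unfolding colombeau_def by blast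
  have "(\<Union>u\<in>U. \<Union>v\<in>V. colombeau_rel \<Omega>' `` {F u v}) = (\<Union>u'\<in>U. \<Union>v'\<in>V. colombeau_rel \<Omega>' `` {F u v})"
    by (intro SUP_cong refl equiv_class_eq[OF E' F_rel] uv)
  also have "\<dots> = colombeau_rel \<Omega>' `` {F u v}"
    using uv by auto
  finally have "(\<Union>u\<in>U. \<Union>v\<in>V. colombeau_rel \<Omega>' `` {F u v}) = colombeau_rel \<Omega>' `` {F u v}" .
  then show "(\<Union>u\<in>U. \<Union>v\<in>V. colombeau_rel \<Omega>' `` {F u v}) \<in> colombeau \<Omega>'"
    using F_mod[OF uv] by (auto simp: colombeau_def intro: quotientI)
qed

subsection \<open>A common family containing all groups\<close>

lemma Basis_point: "(Basis :: point set) = {(1, 0), (0, 1)}"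
  by (auto simp: Basis_prod_def)

lemma dir_deriv_point:
  fixes f :: "point \<Rightarrow> real"
  assumes "f differentiable (at p)"
  shows "dir_deriv (x, t) f p = x * partial_x f p + t * partial_t f p"
  by (subst dir_deriv_components[OF assms]) (simp add: Basis_point)

lemma Delta_cong:
  assumes "open S" "p \<in> S" "\<And>p. p \<in> S \<Longrightarrow> u p = u' p" "\<And>p. p \<in> S \<Longrightarrow> v p = v' p"
  shows "Delta1 u v p = Delta1 u' v' p" "Delta2 u v p = Delta2 u' v' p"
  unfolding Delta1_def Delta2_def
  by (intro arg_cong2[of _ _ _ _ "(+)"] dir_deriv_cong_open[OF assms(1,2)]; simp add: assms(3,4))+

lemma smooth_on_Delta:
  assumes "open S" "smooth_on S u" "smooth_on S v"
  shows "smooth_on S (Delta1 u v)" "smooth_on S (Delta2 u v)"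
  unfolding Delta1_def Delta2_def
  by (intro smooth_on_add smooth_on_dir_deriv smooth_on_mult smooth_on_power assms; simp add: Basis_point)+

lemma smooth_on_fst: "smooth_on S (fst :: point \<Rightarrow> real)"
  and smooth_on_snd: "smooth_on S (snd :: point \<Rightarrow> real)"
  by (intro smooth_on_linear bounded_linear_fst bounded_linear_snd)+

text \<open>\<open>X\<close> is the action on \<open>(x, t)\<close>, and \<open>u\<close>, \<open>v\<close> become \<open>q u\<close> and \<open>w + k v\<close>: a density
  is divided by the stretching \<open>a / q\<close> of \<open>x\<close> at fixed \<open>t\<close> (up to the constant \<open>a\<close>), and \<open>w + k v\<close> is
  the image of a velocity \<open>v = dx/dt\<close> under the derivative of \<open>X\<close>.\<close>

locale galilean_projective =
  fixes a b c d e h :: real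
  assumes a_pos: "a > 0" and det_pos: "d + h * e > 0"
begin

definition q :: "point \<Rightarrow> real" where
  "q p = 1 - h * snd p"

definition w :: "point \<Rightarrow> real" where
  "w p = (a * h * fst p + b + c * h) / (d + h * e)"

definition k :: "point \<Rightarrow> real" where
  "k p = a * q p / (d + h * e)"

definition X :: "point \<Rightarrow> point" where
  "X p = ((a * fst p + b * snd p + c) / q p, (d * snd p + e) / q p)"

text \<open>The denominator of the inverse map: \<open>X\<close> carries the half plane
  \<open>0 < q p\<close> onto \<open>0 < r p\<close>.\<close>

definition r :: "point \<Rightarrow> real" where
  "r p = d + h * snd p"

text \<open>The second component solves the equation for t; inserting it turns \<open>q\<close> into
  \<open>(d + h * e) / r p\<close>, and the first component then solves a x + b t + c = x' q for x,
  where x' is the given first coordinate.\<close>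

definition Y :: "point \<Rightarrow> point" where
  "Y p = ((fst p * ((d + h * e) / r p) - b * ((snd p - e) / r p) - c) / a, (snd p - e) / r p)"

lemma open_q: "open {p. 0 < q p}" and open_r: "open {p. 0 < r p}"
  unfolding q_def r_def by (intro open_Collect_less continuous_intros)+

lemma r_X: "0 < q p \<Longrightarrow> r (X p) = (d + h * e) / q p"
  unfolding r_def X_def by (simp add: q_def field_simps)

lemma q_Y: "0 < r p \<Longrightarrow> q (Y p) = (d + h * e) / r p"
  unfolding q_def Y_def by (simp add: r_def field_simps)

lemma r_X_pos: "0 < q p \<Longrightarrow> 0 < r (X p)"
  and q_Y_pos: "0 < r p \<Longrightarrow> 0 < q (Y p)"
  using det_pos by (simp_all add: r_X q_Y)

lemma Y_X: assumes "0 < q p" shows "Y (X p) = p"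
proof -
  have "(snd (X p) - e) / r (X p) = (snd (X p) - e) * q p / (d + h * e)"
    using assms by (simp add: r_X)
  also have "(snd (X p) - e) * q p = snd p * (d + h * e)"
    using assms by (simp add: X_def q_def field_simps)
  finally have s: "(snd (X p) - e) / r (X p) = snd p"
    using det_pos by simp
  have "fst (X p) * ((d + h * e) / r (X p)) = a * fst p + b * snd p + c"
    using assms det_pos by (simp add: r_X) (simp add: X_def)
  then show ?thesis using a_pos
    by (simp add: Y_def s prod_eq_iff)
qed

lemma X_Y: assumes "0 < r p" shows "X (Y p) = p"
proof -
  have "a * fst (Y p) + b * snd (Y p) + c = fst p * q (Y p)"
    using a_pos assms by (simp add: q_Y) (simp add: Y_def)
  moreover have "d * snd (Y p) + e = snd p * q (Y p)"
    using assms by (simp add: q_Y) (simp add: Y_def r_def field_simps)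
  ultimately show ?thesis
    using q_Y_pos[OF assms] by (simp add: X_def prod_eq_iff)
qed

lemma smooth_on_q: "open S \<Longrightarrow> smooth_on S q" and smooth_on_r: "open S \<Longrightarrow> smooth_on S r"
  unfolding q_def r_def by (intro smooth_on_intros smooth_on_fst smooth_on_snd; assumption)+

lemma smooth_on_w: "open S \<Longrightarrow> smooth_on S w" and smooth_on_k: "open S \<Longrightarrow> smooth_on S k"
  unfolding w_def k_def using det_pos
  by (intro smooth_on_intros smooth_on_fst smooth_on_snd smooth_on_q; simp)+

lemma smooth_on_X: "smooth_on {p. 0 < q p} X"
  unfolding X_def
  by (intro smooth_on_intros smooth_on_fst smooth_on_snd smooth_on_q open_q) auto

lemma smooth_on_Y: "smooth_on {p. 0 < r p} Y"
  unfolding Y_def using a_pos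
  by (intro smooth_on_intros smooth_on_fst smooth_on_snd smooth_on_r open_r) auto

text \<open>The image is the preimage of \<Omega> under the inverse \<open>Y\<close>, which is
  continuous on its open half plane.\<close>

lemma open_image_X:
  assumes "open \<Omega>" "\<Omega> \<subseteq> {p. 0 < q p}"
  shows "open (X ` \<Omega>)"
proof -
  have "X ` \<Omega> = {p. 0 < r p} \<inter> Y -` \<Omega>"
    using assms(2) r_X_pos Y_X X_Y by (force simp: image_iff)
  then show ?thesis
    using continuous_open_preimage[OF smooth_on_continuous[OF smooth_on_Y] open_r assms(1)] by simp
qed

section \<open>Transformation of derivatives and of the two equations\<close>

text \<open>These are the columns of the inverse of the Jacobian matrix of \<open>X\<close> at
  \<open>p\<close>. At fixed t, \<open>X\<close> stretches x by a / q; time is stretched by (d + h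
  e) / q ^ 2; and \<open>w\<close> is the new velocity of a particle at rest, which accounts for the
  mixed entry.\<close>

lemma dir_deriv_Y:
  assumes "0 < q p"
  shows "dir_deriv (1, 0) Y (X p) = (q p / a, 0)"
    and "dir_deriv (0, 1) Y (X p) = (- (q p * w p / a), (q p)\<^sup>2 / (d + h * e))"
proof -
  let ?D = "d + h * e"
  define R where "R = r (X p)"
  have R: "R = ?D / q p" "R \<noteq> 0" using r_X[OF assms] r_X_pos[OF assms] by (simp_all add: R_def del: divide_eq_0_iff)
  have r': "(r has_derivative (\<lambda>z. h * snd z)) (at (X p))"
    unfolding r_def by (auto intro!: derivative_eq_intros)
  define i where "i = (\<lambda>z. inverse (r z))"
  have i': "(i has_derivative (\<lambda>z. - (h * snd z / (R * R)))) (at (X p))"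
    using Deriv.has_derivative_inverse[OF R(2)[unfolded R_def] r']
    by (simp add: i_def R_def divide_inverse mult_ac)
  have iX: "i (X p) = 1 / R" by (simp add: i_def R_def divide_inverse)
  \<comment> \<open>The free factor \<open>s\<close> stands for 1 / a, and \<open>i\<close> for 1 /
    r, so that the derivative rules meet products only.\<close>
  have "((\<lambda>z. ((fst z * (?D * i z) - b * ((snd z - e) * i z) - c) * s, (snd z - e) * i z)) has_derivative
     (\<lambda>z. ((fst z * (?D / R) - fst (X p) * (?D * (h * snd z / (R * R)))
         - b * (snd z / R - (snd (X p) - e) * (h * snd z / (R * R)))) * s,
      snd z / R - (snd (X p) - e) * (h * snd z / (R * R))))) (at (X p))" for s
    by (auto intro!: derivative_eq_intros i' simp: iX algebra_simps add_divide_distrib)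
  note this[of "inverse a", folded divide_inverse]
  moreover have "Y = (\<lambda>z. ((fst z * (?D * i z) - b * ((snd z - e) * i z) - c) / a, (snd z - e) * i z))"
    by (simp add: Y_def i_def divide_inverse fun_eq_iff)
  ultimately have der: "(Y has_derivative
     (\<lambda>z. ((fst z * (?D / R) - fst (X p) * (?D * (h * snd z / (R * R)))
         - b * (snd z / R - (snd (X p) - e) * (h * snd z / (R * R)))) / a,
      snd z / R - (snd (X p) - e) * (h * snd z / (R * R))))) (at (X p))"
    by simp
  show "dir_deriv (1, 0) Y (X p) = (q p / a, 0)"
    using assms det_pos by (subst dir_deriv_eq[OF der]) (simp add: R(1))
  have "1 / R - (snd (X p) - e) * (h * 1 / (R * R)) = (R - (snd (X p) - e) * h) / (R * R)"
    using R(2) by (simp add: field_simps)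
  also have "R - (snd (X p) - e) * h = ?D" by (simp add: R_def r_def algebra_simps)
  also have 1: "?D / (R * R) = (q p)\<^sup>2 / ?D"
    using assms det_pos by (simp add: R(1) power2_eq_square)
  finally have 2: "1 / R - (snd (X p) - e) * (h * 1 / (R * R)) = (q p)\<^sup>2 / ?D" .
  have "0 * (?D / R) - fst (X p) * (?D * (h * 1 / (R * R))) - b * ((q p)\<^sup>2 / ?D) =
      - ((q p)\<^sup>2 / ?D * (fst (X p) * h + b))"
    unfolding 1[symmetric] by (simp add: algebra_simps)
  \<comment> \<open>With p = (x, t), the terms in t cancel in b q + h (a x + b t + c) = a h x + b +
    c h, which is the numerator of \<open>w\<close>.\<close>
  also have "\<dots> = - (q p * w p)"
    using assms by (simp add: power2_eq_square X_def w_def) (simp add: q_def field_simps)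
  finally show "dir_deriv (0, 1) Y (X p) = (- (q p * w p / a), (q p)\<^sup>2 / ?D)"
    unfolding dir_deriv_eq[OF der] fst_conv snd_conv 2 by simp
qed

lemma partial_compose_Y:
  fixes f :: "point \<Rightarrow> real"
  assumes "0 < q p" "f differentiable (at p)"
  shows "partial_x (\<lambda>z. f (Y z)) (X p) = q p / a * partial_x f p"
    and "partial_t (\<lambda>z. f (Y z)) (X p) =
      (q p)\<^sup>2 / (d + h * e) * partial_t f p - q p * w p / a * partial_x f p"
proof -
  have "Y differentiable (at (X p))" "f differentiable (at (Y (X p)))"
    using smooth_on_differentiable[OF smooth_on_Y] r_X_pos assms by (auto simp: Y_X)
  note * = dir_deriv_compose[OF this] 
  show "partial_x (\<lambda>z. f (Y z)) (X p) = q p / a * partial_x f p"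
    and "partial_t (\<lambda>z. f (Y z)) (X p) =
      (q p)\<^sup>2 / (d + h * e) * partial_t f p - q p * w p / a * partial_x f p"
    unfolding * dir_deriv_Y[OF assms(1)] Y_X[OF assms(1)] by (subst dir_deriv_point[OF assms(2)], simp)+
qed

text \<open>With v' = w + k v and D = d + h e, the material derivative \<partial>_t + v \<partial>_x
  is multiplied by q ^ 2 / D, since the contribution of \<open>w\<close> cancels. In the continuity
  equation the derivative of the density factor \<open>q\<close> cancels against that of
  \<open>w\<close> in the divergence of v'. In the second equation, written as v \<Delta>1 + u (v_t
  + v v_x), the x-derivative of \<open>w\<close> cancels the t-derivative of \<open>k\<close>; hence
  the combination of \<open>w\<close> and \<open>k\<close> on the right.\<close>

lemma Delta_transform:
  assumes p: "0 < q p" and u: "u differentiable (at p)" and v: "v differentiable (at p)"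
  shows "Delta1 (\<lambda>z. q (Y z) * u (Y z)) (\<lambda>z. w (Y z) + k (Y z) * v (Y z)) (X p) =
      q p ^ 3 / (d + h * e) * Delta1 u v p" (is ?D1)
    and "Delta2 (\<lambda>z. q (Y z) * u (Y z)) (\<lambda>z. w (Y z) + k (Y z) * v (Y z)) (X p) =
      q p ^ 3 / (d + h * e) * (w p * Delta1 u v p + k p * Delta2 u v p)" (is ?D2)
proof -
  let ?D = "d + h * e"
  note u' = has_derivative_dir_deriv[OF u] and v' = has_derivative_dir_deriv[OF v]
  have q': "(q has_derivative (\<lambda>z. - h * snd z)) (at p)"
    unfolding q_def by (auto intro!: derivative_eq_intros)
  have k': "(k has_derivative (\<lambda>z. - a * h * snd z / ?D)) (at p)"
    unfolding k_def q_def using det_pos by (auto intro!: derivative_eq_intros)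
  have w': "(w has_derivative (\<lambda>z. a * h * fst z / ?D)) (at p)"
    unfolding w_def using det_pos by (auto intro!: derivative_eq_intros)
  let ?u = "\<lambda>p. q p * u p" and ?v = "\<lambda>p. w p + k p * v p"
  note U = has_derivative_mult[OF q' u'] and V = has_derivative_add[OF w' has_derivative_mult[OF k' v']]
  note UV = has_derivative_mult[OF U V]
  note UVV = has_derivative_mult[OF UV V]
  note dU = partial_compose_Y[OF p differentiableI[OF U], unfolded dir_deriv_eq[OF U]]
    and dUV = partial_compose_Y[OF p differentiableI[OF UV], unfolded dir_deriv_eq[OF UV]]
    and dUVV = partial_compose_Y[OF p differentiableI[OF UVV], unfolded dir_deriv_eq[OF UVV]]
  note uv = has_derivative_mult[OF u' v']
  note uvv = has_derivative_mult[OF uv v']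
  have D1: "Delta1 u v p = partial_t u p + (partial_x u p * v p + u p * partial_x v p)"
    unfolding Delta1_def dir_deriv_eq[OF uv] by simp
  have D2: "Delta2 u v p = (partial_t u p * v p + u p * partial_t v p) +
     (partial_x u p * v p * v p + u p * partial_x v p * v p + u p * v p * partial_x v p)"
    unfolding Delta2_def power2_eq_square mult.assoc[symmetric] dir_deriv_eq[OF uv] dir_deriv_eq[OF uvv]
    by (simp add: algebra_simps)
  have nz: "a \<noteq> 0" "?D \<noteq> 0" using a_pos det_pos by auto
  \<comment> \<open>With this relation both identities are polynomial; the inverse of
    \<open>d + h * e\<close> is carried as an indeterminate.\<close>
  have aa: "a * inverse a = 1" using nz by simp
  show ?D1
    unfolding D1 unfolding Delta1_def dU dUV unfolding k_def divide_inverse 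
    using aa by simp algebra
  show ?D2
    unfolding D1 D2 unfolding Delta2_def power2_eq_square mult.assoc[symmetric] dUV dUVV unfolding k_def divide_inverse
    using aa by simp algebra
qed

end

subsection \<open>Test functions and integrals\<close>

lemma test_functionsD:
  assumes "\<phi> \<in> test_functions \<Omega>"
  shows "smooth_on UNIV \<phi>" "compact (supp \<phi>)" "supp \<phi> \<subseteq> \<Omega>"
  using assms by (simp_all add: test_functions_def)

lemma in_supp: "\<phi> p \<noteq> 0 \<Longrightarrow> p \<in> supp \<phi>"
  unfolding supp_def using closure_subset[of "{p. \<phi> p \<noteq> 0}"] by blast

text \<open>Although \<open>g\<close> may blow up at the boundary of \<Omega> and is arbitrary
  outside, the product is continuous on the compact support of \<phi> and vanishes elsewhere in
  \<Omega>.\<close>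

lemma set_integrable_test_function:
  assumes "continuous_on \<Omega> g" "\<phi> \<in> test_functions \<Omega>"
  shows "set_integrable lborel \<Omega> (\<lambda>p. g p * \<phi> p)"
proof -
  note \<phi> = test_functionsD[OF assms(2)]
  have "continuous_on (supp \<phi>) (\<lambda>p. g p * \<phi> p)"
    by (intro continuous_on_mult continuous_on_subset[OF assms(1) \<phi>(3)]
        continuous_on_subset[OF smooth_on_continuous[OF \<phi>(1)] subset_UNIV])
  then have "integrable lborel (\<lambda>p. indicator (supp \<phi>) p *\<^sub>R (g p * \<phi> p))"
    by (rule borel_integrable_compact[OF \<phi>(2)])
  also have "(\<lambda>p. indicator (supp \<phi>) p *\<^sub>R (g p * \<phi> p)) = (\<lambda>p. indicator \<Omega> p *\<^sub>R (g p * \<phi> p))"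
  proof
    show "indicator (supp \<phi>) p *\<^sub>R (g p * \<phi> p) = indicator \<Omega> p *\<^sub>R (g p * \<phi> p)" for p
      using in_supp[of \<phi> p] subsetD[OF \<phi>(3), of p] by (cases "\<phi> p = 0") simp_all
  qed
  finally show ?thesis by (simp only: set_integrable_def)
qed

text \<open>A single function is a constant net, so this is the pullback of moderate nets read off
  at \<epsilon> = 1.\<close>

lemma smooth_on_pullback:
  fixes f :: "point \<Rightarrow> real" and \<Theta> :: "point \<Rightarrow> point"
  assumes "open S" "\<Theta> ` S \<subseteq> T" "smooth_on S \<Theta>" "smooth_on S \<kappa>" "smooth_on T f"
  shows "smooth_on S (\<lambda>p. \<kappa> p * f (\<Theta> p))"
  using moderate_nets_smooth[OF moderate_nets_pullback[OF assms(1-4) smooth_moderate[OF assms(5)]], of 1]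
  by simp

lemma abs_bilinear_le:
  fixes s p k x y t z :: real
  shows "\<bar>s * p + k * (x * y + t * z)\<bar> \<le> \<bar>s\<bar> * \<bar>p\<bar> + \<bar>k\<bar> * (\<bar>x\<bar> * \<bar>y\<bar> + \<bar>t\<bar> * \<bar>z\<bar>)"
proof -
  have *: "\<bar>x * y + t * z\<bar> \<le> \<bar>x\<bar> * \<bar>y\<bar> + \<bar>t\<bar> * \<bar>z\<bar>"
    using abs_triangle_ineq[of "x * y" "t * z"] by (simp add: abs_mult)
  have "\<bar>s * p + k * (x * y + t * z)\<bar> \<le> \<bar>s\<bar> * \<bar>p\<bar> + \<bar>k\<bar> * \<bar>x * y + t * z\<bar>"
    using abs_triangle_ineq[of "s * p" "k * (x * y + t * z)"] by (simp add: abs_mult)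
  also have "\<dots> \<le> \<bar>s\<bar> * \<bar>p\<bar> + \<bar>k\<bar> * (\<bar>x\<bar> * \<bar>y\<bar> + \<bar>t\<bar> * \<bar>z\<bar>)"
    by (intro add_left_mono mult_left_mono *) simp
  finally show ?thesis .
qed

section \<open>Change of variables and pullback of test functions\<close>

context galilean_projective
begin

text \<open>Fubini reduces the plane to two one-dimensional substitutions, because \<open>X\<close>
  preserves the lines t = const: an affine one in x with slope a / q and a fractional linear one in
  t with derivative (d + h e) / q ^ 2. Their product is the Jacobian. Integrability on both sides is
  what Fubini uses on each.\<close>

lemma integral_transform:
  fixes F :: "point \<Rightarrow> real"
  assumes F: "integrable lborel F" and F0: "\<And>p. \<not> 0 < r p \<Longrightarrow> F p = 0"
    and H: "integrable lborel (\<lambda>p. if 0 < q p then F (X p) * (a * (d + h * e) / q p ^ 3) else 0)"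
  shows "(LINT p|lborel. F p) =
    (LINT p|lborel. (if 0 < q p then F (X p) * (a * (d + h * e) / q p ^ 3) else 0))"
proof -
  let ?D = "d + h * e"
  define H' where "H' p = (if 0 < q p then F (X p) * (a * ?D / q p ^ 3) else 0)" for p
  define G where "G t = (LINT x|lborel. F (x, t))" for t
  define K where "K t = (LINT x|lborel. H' (x, t))" for t
  define I where "I = {t. 0 < 1 - h * t}"
  define I' where "I' = {t. 0 < d + h * t}"
  define \<tau> where "\<tau> t = (d * t + e) / (1 - h * t)" for t
  define \<tau>' where "\<tau>' t = ?D / (1 - h * t)\<^sup>2" for t
  have F2: "integrable (lborel \<Otimes>\<^sub>M lborel) (\<lambda>(x, t). F (x, t))"
    and H2: "integrable (lborel \<Otimes>\<^sub>M lborel) (\<lambda>(x, t). H' (x, t))"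
    using F H[folded H'_def] by (simp_all add: lborel_prod)
  have iG: "integrable lborel G" and LG: "(LINT t|lborel. G t) = (LINT p|lborel. F p)"
    unfolding G_def using lborel_pair.integrable_snd[OF F2] lborel_pair.integral_snd[OF F2]
    by (simp_all add: lborel_prod)
  have iK: "integrable lborel K" and LK: "(LINT t|lborel. K t) = (LINT p|lborel. H' p)"
    unfolding K_def using lborel_pair.integrable_snd[OF H2] lborel_pair.integral_snd[OF H2]
    by (simp_all add: lborel_prod)
  have G0: "G t = 0" if "t \<notin> I'" for t
    using that F0 by (simp add: G_def I'_def r_def)
  \<comment> \<open>The inner substitution: integrating over x at the new time \<tau> t costs the
    factor a / (1 - h t), which joins \<open>\<tau>' t\<close> to form the Jacobian.\<close>
  have K: "K t = indicator I t *\<^sub>R (\<bar>\<tau>' t\<bar> * G (\<tau> t))" for t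
  proof (cases "t \<in> I")
    case True
    then have s: "0 < 1 - h * t" by (simp add: I_def)
    let ?s = "1 - h * t"
    have affine: "(b * t + c) / ?s + (a / ?s) * x = (a * x + b * t + c) / ?s" for x
      by (simp add: add_divide_distrib)
    have "G (\<tau> t) = (a / ?s) * (LINT x|lborel. F ((b * t + c) / ?s + (a / ?s) * x, \<tau> t))"
      unfolding G_def using s a_pos
      by (subst lborel_integral_real_affine[where c = "a / ?s" and t = "(b * t + c) / ?s"]) auto
    also have "(\<lambda>x. F ((b * t + c) / ?s + (a / ?s) * x, \<tau> t)) = (\<lambda>x. F (X (x, t)))"
      by (simp only: affine) (simp add: X_def q_def \<tau>_def)
    finally have "\<bar>\<tau>' t\<bar> * G (\<tau> t) = (a * ?D / ?s ^ 3) * (LINT x|lborel. F (X (x, t)))"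
      using s det_pos by (simp add: \<tau>'_def power2_eq_square power3_eq_cube)
    also have "\<dots> = K t"
      using s by (simp add: K_def H'_def q_def mult.commute)
    finally show ?thesis using True by simp
  qed (simp add: K_def H'_def q_def I_def)
  have inv: "d + h * \<tau> t = ?D / (1 - h * t)" if "t \<in> I" for t
    using that by (simp add: I_def \<tau>_def field_simps)
  have image: "\<tau> ` I = I'"
  proof
    show "\<tau> ` I \<subseteq> I'" using inv det_pos by (auto simp: I'_def) (simp add: I_def)
    show "I' \<subseteq> \<tau> ` I"
    proof
      fix t assume t: "t \<in> I'"
      have *: "1 - h * ((t - e) / (d + h * t)) = ?D / (d + h * t)"
        using t by (simp add: I'_def field_simps)
      have "0 < ?D / (d + h * t)" using t det_pos by (simp add: I'_def)
      then have "(t - e) / (d + h * t) \<in> I" unfolding I_def mem_Collect_eq * .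
      moreover have "\<tau> ((t - e) / (d + h * t)) = t"
      proof -
        have "d * ((t - e) / (d + h * t)) + e = t * (?D / (d + h * t))"
          using t by (simp add: I'_def field_simps)
        then show ?thesis unfolding \<tau>_def * using t det_pos by (simp add: I'_def)
      qed
      ultimately show "t \<in> \<tau> ` I" by (metis imageI)
    qed
  qed
  have inj: "inj_on \<tau> I"
  proof (rule inj_onI)
    fix t s assume ts: "t \<in> I" "s \<in> I" "\<tau> t = \<tau> s"
    then have "?D / (1 - h * t) = ?D / (1 - h * s)" using inv by metis
    then have "1 - h * t = 1 - h * s" using det_pos ts by (simp add: I_def field_simps)
    moreover from this have "d * t + e = d * s + e"
      using ts(1,2) arg_cong2[OF _ ts(3), of "1 - h * t" "1 - h * s" "(*)"] by (simp add: \<tau>_def I_def)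
    \<comment> \<open>Either of d and h may vanish; the combination d t + e (h t) separates points
      in every case.\<close>
    ultimately have "?D * t = ?D * s" by algebra
    then show "t = s" using det_pos by simp
  qed
  have der: "(\<tau> has_field_derivative \<tau>' t) (at t within I)" if "t \<in> I" for t
  proof -
    have "(\<tau> has_field_derivative
        (d * (1 - h * t) - (d * t + e) * (- h)) / ((1 - h * t) * (1 - h * t))) (at t within I)"
      unfolding \<tau>_def using that
      by (intro DERIV_divide) (auto intro!: derivative_eq_intros simp: I_def)
    moreover have "d * (1 - h * t) - (d * t + e) * (- h) = ?D" by algebra
    ultimately show ?thesis by (simp only: \<tau>'_def power2_eq_square)
  qed
  have "open I" "open I'"
    unfolding I_def I'_def by (intro open_Collect_less continuous_intros)+
  then have I: "I \<in> sets lebesgue" and I': "I' \<in> sets lebesgue" by auto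
  \<comment> \<open>The substitution in t is a statement about the completed measure; for the Borel
    integrable \<open>G\<close> and \<open>K\<close> both integrals agree.\<close>
  have leb: "integrable lebesgue G"
    using iG by (simp add: integrable_completion)
  have G_eq: "G = (\<lambda>t. indicator I' t *\<^sub>R G t)"
    by (rule ext) (use G0 in \<open>auto simp: indicator_def\<close>)
  have absG: "G absolutely_integrable_on I'"
    unfolding set_integrable_def G_eq[symmetric] by (rule leb)
  then have cov: "(\<lambda>t. \<bar>\<tau>' t\<bar> * G (\<tau> t)) absolutely_integrable_on I"
      "integral I (\<lambda>t. \<bar>\<tau>' t\<bar> * G (\<tau> t)) = integral I' G"
    using has_absolute_integral_change_of_variables_1'[OF I der inj, of G "integral I' G"] image by auto
  have "(LINT t|lborel. G t) = (LINT t|lebesgue. G t)"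
    using iG by (intro integral_completion[symmetric]) auto
  also have "\<dots> = (LINT t:I'|lebesgue. G t)"
    unfolding set_lebesgue_integral_def G_eq[symmetric] ..
  also have "\<dots> = (LINT t:I|lebesgue. \<bar>\<tau>' t\<bar> * G (\<tau> t))"
    using set_lebesgue_integral_eq_integral(2)[OF absG] set_lebesgue_integral_eq_integral(2)[OF cov(1)] cov(2)
    by simp
  also have "\<dots> = (LINT t|lebesgue. K t)"
    by (simp add: set_lebesgue_integral_def K)
  also have "\<dots> = (LINT t|lborel. K t)"
    using iK by (intro integral_completion) auto
  finally show ?thesis
    unfolding LG LK H'_def .
qed

text \<open>The dual action on test functions. The value 0 is set explicitly outside \<Omega>, where
  neither the multiplier nor \<open>X\<close> is controlled.\<close>

definition pull :: "point set \<Rightarrow> (point \<Rightarrow> real) \<Rightarrow> (point \<Rightarrow> real) \<Rightarrow> point \<Rightarrow> real" where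
  "pull \<Omega> \<kappa> \<phi> p = (if p \<in> \<Omega> then \<kappa> p * \<phi> (X p) else 0)"

lemma Y_image_compact:
  assumes \<Omega>: "open \<Omega>" "\<Omega> \<subseteq> {p. 0 < q p}" and K: "compact K" "K \<subseteq> X ` \<Omega>"
  shows "compact (Y ` K)" "Y ` K \<subseteq> \<Omega>"
proof -
  have "K \<subseteq> {p. 0 < r p}" using K(2) \<Omega>(2) r_X_pos by blast
  then have "continuous_on K Y"
    using smooth_on_continuous[OF smooth_on_Y] continuous_on_subset by blast
  then show "compact (Y ` K)" using K(1) by (rule compact_continuous_image)
  show "Y ` K \<subseteq> \<Omega>" using K(2) \<Omega>(2) Y_X by force
qed

lemma supp_pull:
  assumes "open \<Omega>" "\<Omega> \<subseteq> {p. 0 < q p}" "compact K" "K \<subseteq> X ` \<Omega>" "supp \<phi> \<subseteq> K"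
  shows "supp (pull \<Omega> \<kappa> \<phi>) \<subseteq> Y ` K"
  unfolding supp_def
proof (rule closure_minimal)
  show "closed (Y ` K)" using Y_image_compact[OF assms(1-4)] compact_imp_closed by blast
  show "{p. pull \<Omega> \<kappa> \<phi> p \<noteq> 0} \<subseteq> Y ` K"
  proof
    fix p assume "p \<in> {p. pull \<Omega> \<kappa> \<phi> p \<noteq> 0}"
    then have p: "p \<in> \<Omega>" "\<phi> (X p) \<noteq> 0" by (auto simp: pull_def split: if_splits)
    then have "X p \<in> K" "Y (X p) = p" using in_supp[of \<phi> "X p"] assms(2,5) Y_X[of p] by blast+
    then show "p \<in> Y ` K" by (metis imageI)
  qed
qed

lemma pull_test_functions:
  assumes \<Omega>: "open \<Omega>" "\<Omega> \<subseteq> {p. 0 < q p}" and \<kappa>: "smooth_on \<Omega> \<kappa>"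
    and \<phi>: "\<phi> \<in> test_functions (X ` \<Omega>)"
  shows "pull \<Omega> \<kappa> \<phi> \<in> test_functions \<Omega>"
proof -
  note \<phi>' = test_functionsD[OF \<phi>]
  note K = Y_image_compact[OF \<Omega> \<phi>'(2,3)]
  note sub = supp_pull[OF \<Omega> \<phi>'(2,3) order_refl, of \<kappa>]
  have "smooth_on \<Omega> (\<lambda>p. \<kappa> p * \<phi> (X p))"
    by (rule smooth_on_pullback[OF \<Omega>(1) subset_UNIV smooth_on_subset[OF smooth_on_X \<Omega>(2)] \<kappa> \<phi>'(1)])
  then have "smooth_on \<Omega> (pull \<Omega> \<kappa> \<phi>)"
    by (subst smooth_on_cong[OF \<Omega>(1)]) (auto simp: pull_def)
  moreover have "smooth_on (- Y ` supp \<phi>) (pull \<Omega> \<kappa> \<phi>)"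
  proof (subst smooth_on_cong)
    show "open (- Y ` supp \<phi>)" using K(1) compact_imp_closed by blast
    show "pull \<Omega> \<kappa> \<phi> p = 0" if "p \<in> - Y ` supp \<phi>" for p
      using that sub in_supp by blast
  qed simp
  ultimately have "smooth_on (\<Omega> \<union> - Y ` supp \<phi>) (pull \<Omega> \<kappa> \<phi>)" by (rule smooth_on_Un)
  moreover have "\<Omega> \<union> - Y ` supp \<phi> = UNIV" using K(2) by blast
  moreover have "compact (supp (pull \<Omega> \<kappa> \<phi>))"
    using compact_Int_closed[OF K(1), of "supp (pull \<Omega> \<kappa> \<phi>)"] sub by (simp add: Int_absorb1 supp_def)
  ultimately show ?thesis using sub K(2) by (auto simp: test_functions_def)
qed

lemma pull_bounded_in_C1c:
  assumes \<Omega>: "open \<Omega>" "\<Omega> \<subseteq> {p. 0 < q p}" and \<kappa>: "smooth_on \<Omega> \<kappa>"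
    and B: "B \<subseteq> test_functions (X ` \<Omega>)" "bounded_in_C1c (X ` \<Omega>) B"
  shows "bounded_in_C1c \<Omega> (pull \<Omega> \<kappa> ` B)"
proof -
  from B(2) obtain K C where K: "compact K" "K \<subseteq> X ` \<Omega>" "\<And>\<phi>. \<phi> \<in> B \<Longrightarrow> supp \<phi> \<subseteq> K"
    and C: "\<And>\<phi> p. \<phi> \<in> B \<Longrightarrow> \<bar>\<phi> p\<bar> \<le> C \<and> \<bar>partial_x \<phi> p\<bar> \<le> C \<and> \<bar>partial_t \<phi> p\<bar> \<le> C"
    unfolding bounded_in_C1c_def by blast
  note YK = Y_image_compact[OF \<Omega> K(1,2)]
  note sub = supp_pull[OF \<Omega> K(1,2) K(3), of _ \<kappa>]
  have X: "smooth_on \<Omega> X" by (rule smooth_on_subset[OF smooth_on_X \<Omega>(2)])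
  have bnd: "\<exists>M\<ge>0. \<forall>p\<in>Y ` K. norm (f p) \<le> M" if "smooth_on \<Omega> f" for f :: "point \<Rightarrow> 'z::real_normed_vector"
  proof -
    have "continuous_on (Y ` K) f"
      using smooth_on_continuous[OF that] YK(2) continuous_on_subset by blast
    then have "bounded (f ` Y ` K)"
      using YK(1) by (meson compact_continuous_image compact_imp_bounded)
    then obtain M where "\<forall>p\<in>Y ` K. norm (f p) \<le> M" by (auto simp: bounded_iff)
    then show ?thesis by (intro exI[of _ "\<bar>M\<bar>"]) force
  qed
  obtain M where M: "M \<ge> 0" "\<And>p. p \<in> Y ` K \<Longrightarrow> \<bar>\<kappa> p\<bar> \<le> M"
    using bnd[OF \<kappa>] unfolding real_norm_def by blast
  have zero: "pull \<Omega> \<kappa> \<phi> p = 0" if "\<phi> \<in> B" "p \<notin> Y ` K" for \<phi> p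
    using that sub in_supp by blast
  have dirs: "\<exists>M'. \<forall>\<phi>\<in>B. \<forall>p. \<bar>dir_deriv i (pull \<Omega> \<kappa> \<phi>) p\<bar> \<le> M'" if i: "i \<in> Basis" for i
  proof -
    obtain L where L: "L \<ge> 0" "\<And>p. p \<in> Y ` K \<Longrightarrow> \<bar>dir_deriv i \<kappa> p\<bar> \<le> L"
      using bnd[OF smooth_on_dir_deriv[OF \<kappa> i]] unfolding real_norm_def by blast
    obtain N where N: "N \<ge> 0" "\<And>p. p \<in> Y ` K \<Longrightarrow> norm (dir_deriv i X p) \<le> N"
      using bnd[OF smooth_on_dir_deriv[OF X i]] by blast
    \<comment> \<open>\<open>M\<close> bounds \<kappa>, \<open>L\<close> its derivative,
      \<open>N\<close> both components of the derivative of \<open>X\<close>, and \<open>C\<close>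
      the test functions with their first derivatives.\<close>
    have "\<bar>dir_deriv i (pull \<Omega> \<kappa> \<phi>) p\<bar> \<le> L * C + M * (N * C + N * C)" if \<phi>: "\<phi> \<in> B" for \<phi> p
    proof (cases "p \<in> Y ` K")
      case True
      then have p: "p \<in> \<Omega>" using YK(2) by blast
      have \<phi>': "smooth_on UNIV \<phi>" using \<phi> B(1) test_functionsD by blast
      then have d: "\<kappa> differentiable at p" "X differentiable at p" "\<phi> differentiable at (X p)"
        using p \<kappa> X by (auto intro: smooth_on_differentiable)
      obtain x t where xt: "dir_deriv i X p = (x, t)" by fastforce
      have "norm (x, t) \<le> N" using N(2)[OF True] xt by simp
      then have xtN: "\<bar>x\<bar> \<le> N" "\<bar>t\<bar> \<le> N"
        using norm_fst_le[of x t] norm_snd_le[of t x] by simp_all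
      have "dir_deriv i (pull \<Omega> \<kappa> \<phi>) p = dir_deriv i (\<lambda>p. \<kappa> p * \<phi> (X p)) p"
        by (rule dir_deriv_cong_open[OF \<Omega>(1) p]) (simp add: pull_def)
      also have "\<dots> = dir_deriv i \<kappa> p * \<phi> (X p) + \<kappa> p * dir_deriv i (\<lambda>p. \<phi> (X p)) p"
        by (rule dir_deriv_mult[OF d(1) differentiableI[OF has_derivative_compose_dir_deriv[OF d(2,3)]]])
      also have "dir_deriv i (\<lambda>p. \<phi> (X p)) p = x * partial_x \<phi> (X p) + t * partial_t \<phi> (X p)"
        unfolding dir_deriv_compose[OF d(2,3)] xt by (rule dir_deriv_point[OF d(3)])
      finally have "\<bar>dir_deriv i (pull \<Omega> \<kappa> \<phi>) p\<bar> \<le>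
          \<bar>dir_deriv i \<kappa> p\<bar> * \<bar>\<phi> (X p)\<bar> +
          \<bar>\<kappa> p\<bar> * (\<bar>x\<bar> * \<bar>partial_x \<phi> (X p)\<bar> + \<bar>t\<bar> * \<bar>partial_t \<phi> (X p)\<bar>)"
        by (simp only: abs_bilinear_le)
      also have "\<dots> \<le> L * C + M * (N * C + N * C)"
        using L M N xtN C[OF \<phi>] True by (intro add_mono mult_mono) auto
      finally show ?thesis .
    next
      case False
      have "dir_deriv i (pull \<Omega> \<kappa> \<phi>) p = dir_deriv i (\<lambda>p. 0) p"
      proof (rule dir_deriv_cong_open[of "- Y ` K"])
        show "open (- Y ` K)" using YK(1) compact_imp_closed by blast
      qed (use False zero[OF \<phi>] in auto)
      moreover have "0 \<le> C" using C[OF \<phi>] abs_ge_zero order_trans by blast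
      ultimately show ?thesis using L(1) M(1) N(1) by simp
    qed
    then show ?thesis by blast
  qed
  obtain M1 where M1: "\<And>\<phi> p. \<phi> \<in> B \<Longrightarrow> \<bar>partial_x (pull \<Omega> \<kappa> \<phi>) p\<bar> \<le> M1"
    using dirs[of "(1, 0)"] by (auto simp: Basis_point)
  obtain M2 where M2: "\<And>\<phi> p. \<phi> \<in> B \<Longrightarrow> \<bar>partial_t (pull \<Omega> \<kappa> \<phi>) p\<bar> \<le> M2"
    using dirs[of "(0, 1)"] by (auto simp: Basis_point)
  have M0: "\<bar>pull \<Omega> \<kappa> \<phi> p\<bar> \<le> M * C" if \<phi>: "\<phi> \<in> B" for \<phi> p
  proof (cases "p \<in> Y ` K")
    case True
    then have "p \<in> \<Omega>" using YK(2) by blast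
    then show ?thesis using M(1) M(2)[OF True] C[OF \<phi>, of "X p"]
      by (simp add: pull_def abs_mult mult_mono)
  next
    case False
    moreover have "0 \<le> C" using C[OF \<phi>] abs_ge_zero order_trans by blast
    ultimately show ?thesis using zero[OF \<phi>] M(1) by simp
  qed
  show ?thesis
    unfolding bounded_in_C1c_def
  proof (intro conjI)
    show "\<exists>K. compact K \<and> K \<subseteq> \<Omega> \<and> (\<forall>\<psi>\<in>pull \<Omega> \<kappa> ` B. supp \<psi> \<subseteq> K)"
      using YK sub by blast
    show "\<exists>C. \<forall>\<psi>\<in>pull \<Omega> \<kappa> ` B. \<forall>p. \<bar>\<psi> p\<bar> \<le> C \<and> \<bar>partial_x \<psi> p\<bar> \<le> C \<and> \<bar>partial_t \<psi> p\<bar> \<le> C"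
    proof (intro exI[of _ "max (M * C) (max M1 M2)"] ballI allI)
      fix \<psi> p assume "\<psi> \<in> pull \<Omega> \<kappa> ` B"
      then obtain \<phi> where "\<phi> \<in> B" "\<psi> = pull \<Omega> \<kappa> \<phi>" by blast
      then show "\<bar>\<psi> p\<bar> \<le> max (M * C) (max M1 M2) \<and> \<bar>partial_x \<psi> p\<bar> \<le> max (M * C) (max M1 M2) \<and>
          \<bar>partial_t \<psi> p\<bar> \<le> max (M * C) (max M1 M2)"
        using M0[of \<phi> p] M1[of \<phi> p] M2[of \<phi> p] by auto
    qed
  qed
qed

text \<open>The hypothesis \<open>eq\<close> is the pointwise identity already multiplied by the
  Jacobian. Two terms are provided because the transformed second equation mixes both original
  ones.\<close>

lemma integral_pull:
  assumes \<Omega>: "open \<Omega>" "\<Omega> \<subseteq> {p. 0 < q p}" and \<phi>: "\<phi> \<in> test_functions (X ` \<Omega>)"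
    and g: "continuous_on (X ` \<Omega>) g" "continuous_on \<Omega> g\<^sub>1" "continuous_on \<Omega> g\<^sub>2"
    and \<kappa>: "smooth_on \<Omega> \<kappa>\<^sub>1" "smooth_on \<Omega> \<kappa>\<^sub>2"
    and eq: "\<And>p. p \<in> \<Omega> \<Longrightarrow> a * (d + h * e) / q p ^ 3 * g (X p) = \<kappa>\<^sub>1 p * g\<^sub>1 p + \<kappa>\<^sub>2 p * g\<^sub>2 p"
  shows "(LINT p:X ` \<Omega>|lborel. g p * \<phi> p) =
    (LINT p:\<Omega>|lborel. g\<^sub>1 p * pull \<Omega> \<kappa>\<^sub>1 \<phi> p) + (LINT p:\<Omega>|lborel. g\<^sub>2 p * pull \<Omega> \<kappa>\<^sub>2 \<phi> p)"
proof -
  define F where "F p = indicator (X ` \<Omega>) p *\<^sub>R (g p * \<phi> p)" for p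
  let ?H = "\<lambda>p. if 0 < q p then F (X p) * (a * (d + h * e) / q p ^ 3) else 0"
  have F: "integrable lborel F"
    using set_integrable_test_function[OF g(1) \<phi>] unfolding set_integrable_def F_def .
  have F0: "F p = 0" if "\<not> 0 < r p" for p
    using that \<Omega>(2) r_X_pos by (auto simp: F_def indicator_def)
  have H1: "set_integrable lborel \<Omega> (\<lambda>p. g\<^sub>1 p * pull \<Omega> \<kappa>\<^sub>1 \<phi> p)"
    and H2: "set_integrable lborel \<Omega> (\<lambda>p. g\<^sub>2 p * pull \<Omega> \<kappa>\<^sub>2 \<phi> p)"
    by (intro set_integrable_test_function g pull_test_functions \<Omega> \<kappa> \<phi>)+
  have H: "?H p = indicator \<Omega> p *\<^sub>R (g\<^sub>1 p * pull \<Omega> \<kappa>\<^sub>1 \<phi> p + g\<^sub>2 p * pull \<Omega> \<kappa>\<^sub>2 \<phi> p)" for p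
  proof (cases "p \<in> \<Omega>")
    case True
    then have "?H p = (a * (d + h * e) / q p ^ 3 * g (X p)) * \<phi> (X p)"
      using \<Omega>(2) by (auto simp: F_def)
    then show ?thesis using True by (simp only: eq[OF True]) (simp add: pull_def algebra_simps)
  next
    case False
    \<comment> \<open>Injectivity of \<open>X\<close> on the half plane: a point outside \<Omega> is
      not mapped into the image, so the integrand vanishes there too.\<close>
    have "X p \<notin> X ` \<Omega>" if "0 < q p"
    proof
      assume "X p \<in> X ` \<Omega>"
      then obtain p' where "p' \<in> \<Omega>" "X p = X p'" by blast
      then have "p = p'" using Y_X[OF that] Y_X[of p'] \<Omega>(2) by auto
      with False \<open>p' \<in> \<Omega>\<close> show False by simp
    qed
    then show ?thesis using False by (auto simp: F_def)
  qed
  have "(LINT p:X ` \<Omega>|lborel. g p * \<phi> p) = (LINT p|lborel. F p)"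
    by (simp add: F_def set_lebesgue_integral_def)
  also have "\<dots> = (LINT p|lborel. ?H p)"
  proof (rule integral_transform[OF F F0])
    show "integrable lborel ?H"
      unfolding H using set_integral_add(1)[OF H1 H2] by (simp add: set_integrable_def)
  qed
  also have "\<dots> = (LINT p:\<Omega>|lborel. g\<^sub>1 p * pull \<Omega> \<kappa>\<^sub>1 \<phi> p + g\<^sub>2 p * pull \<Omega> \<kappa>\<^sub>2 \<phi> p)"
    unfolding H by (simp add: set_lebesgue_integral_def)
  finally show ?thesis using set_integral_add(2)[OF H1 H2] by simp
qed

end

subsection \<open>Symmetry\<close>

lemma colombeau_moderate: "open \<Omega> \<Longrightarrow> U \<in> colombeau \<Omega> \<Longrightarrow> u \<in> U \<Longrightarrow> u \<in> moderate_nets \<Omega>"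
  unfolding colombeau_def by (rule in_quotient_imp_subset[OF equiv_colombeau_rel, THEN subsetD])

context galilean_projective
begin

text \<open>A single group element is represented, so the locale parameters may depend on \<eta>.
  Formulas are compared on the half plane only, since beyond it the divisions have no geometric
  meaning.\<close>

definition represents :: "transformations \<Rightarrow> real \<Rightarrow> bool" where
  "represents G \<eta> \<longleftrightarrow> Dmn G \<eta> = {p. 0 < q p} \<and> (\<forall>p. 0 < q p \<longrightarrow> Xi G \<eta> p = X p) \<and>
     (\<forall>p s t. 0 < q p \<longrightarrow> Phi G \<eta> p (s, t) = (q p * s, w p + k p * t))"

context
  fixes G \<eta> \<Omega>
  assumes G: "represents G \<eta>" and \<Omega>: "open \<Omega>" "\<Omega> \<subseteq> Dmn G \<eta>"
begin

lemma dom_pos: "\<Omega> \<subseteq> {p. 0 < q p}"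
  using G \<Omega>(2) by (simp add: represents_def)

lemma q_pos: "p \<in> \<Omega> \<Longrightarrow> 0 < q p"
  using dom_pos by blast

lemmas Xi_eq = G[unfolded represents_def, THEN conjunct2, THEN conjunct1, rule_format, OF q_pos]
  and Phi_eq = G[unfolded represents_def, THEN conjunct2, THEN conjunct2, rule_format, OF q_pos]

lemma Xi_image: "Xi G \<eta> ` \<Omega> = X ` \<Omega>"
  by (intro image_cong refl Xi_eq)

lemma open_image: "open (X ` \<Omega>)"
  by (rule open_image_X[OF \<Omega>(1) dom_pos])

lemma Y_image: "Y ` X ` \<Omega> \<subseteq> \<Omega>"
  unfolding image_image by (rule image_subsetI) (simp add: Y_X q_pos)

lemma smooth_Y: "smooth_on (X ` \<Omega>) Y"
  by (rule smooth_on_subset[OF smooth_on_Y]) (simp add: image_subset_iff r_X_pos q_pos)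

lemma smooth_compose_Y: "smooth_on \<Omega> f \<Longrightarrow> smooth_on (X ` \<Omega>) (\<lambda>p. f (Y p))" for f :: "point \<Rightarrow> real"
  using smooth_on_pullback[OF open_image Y_image smooth_Y smooth_on_const[of _ 1], of f] by simp

text \<open>The inverse in \<open>act\<close> is a choice of preimage in \<Omega>; injectivity, due
  to the left inverse \<open>Y\<close>, makes this choice equal to \<open>Y\<close> on the
  image.\<close>

lemma act_eq:
  assumes "p \<in> X ` \<Omega>"
  shows "act_u G \<eta> \<Omega> u v p = q (Y p) * u (Y p)"
    and "act_v G \<eta> \<Omega> u v p = w (Y p) + k (Y p) * v (Y p)"
proof -
  from assms obtain p' where p': "p' \<in> \<Omega>" "p = X p'" by blast
  have "inj_on (Xi G \<eta>) \<Omega>"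
  proof (rule inj_onI)
    fix y z assume yz: "y \<in> \<Omega>" "z \<in> \<Omega>" "Xi G \<eta> y = Xi G \<eta> z"
    have "X y = X z" using yz(3) unfolding Xi_eq[OF yz(1)] Xi_eq[OF yz(2)] .
    from arg_cong[OF this, of Y] show "y = z"
      unfolding Y_X[OF q_pos[OF yz(1)]] Y_X[OF q_pos[OF yz(2)]] .
  qed
  then have "inv_into \<Omega> (Xi G \<eta>) (Xi G \<eta> p') = p'" by (rule inv_into_f_f[OF _ p'(1)])
  then have "inv_into \<Omega> (Xi G \<eta>) p = p'" unfolding Xi_eq[OF p'(1)] p'(2) .
  moreover have "Y p = p'" unfolding p'(2) by (rule Y_X[OF q_pos[OF p'(1)]])
  moreover have "Phi G \<eta> p' (u p', v p') = (q p' * u p', w p' + k p' * v p')"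
    by (rule Phi_eq[OF p'(1)])
  ultimately show "act_u G \<eta> \<Omega> u v p = q (Y p) * u (Y p)"
    and "act_v G \<eta> \<Omega> u v p = w (Y p) + k (Y p) * v (Y p)"
    by (simp_all add: act_u_def act_v_def act_def)
qed

lemma smooth_act:
  assumes "smooth_on \<Omega> u" "smooth_on \<Omega> v"
  shows "smooth_on (X ` \<Omega>) (act_u G \<eta> \<Omega> u v)" "smooth_on (X ` \<Omega>) (act_v G \<eta> \<Omega> u v)"
proof -
  have "smooth_on (X ` \<Omega>) (\<lambda>p. q (Y p) * u (Y p))"
    by (intro smooth_on_mult open_image smooth_compose_Y smooth_on_q \<Omega> assms)
  also have "?this \<longleftrightarrow> smooth_on (X ` \<Omega>) (act_u G \<eta> \<Omega> u v)"
    by (rule smooth_on_cong[OF open_image, symmetric]) (rule act_eq(1))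
  finally show "smooth_on (X ` \<Omega>) (act_u G \<eta> \<Omega> u v)" .
  have "smooth_on (X ` \<Omega>) (\<lambda>p. w (Y p) + k (Y p) * v (Y p))"
    by (intro smooth_on_add smooth_on_mult open_image smooth_compose_Y smooth_on_w smooth_on_k \<Omega> assms)
  also have "?this \<longleftrightarrow> smooth_on (X ` \<Omega>) (act_v G \<eta> \<Omega> u v)"
    by (rule smooth_on_cong[OF open_image, symmetric]) (rule act_eq(2))
  finally show "smooth_on (X ` \<Omega>) (act_v G \<eta> \<Omega> u v)" .
qed

lemma Delta_act:
  assumes "smooth_on \<Omega> u" "smooth_on \<Omega> v" "p \<in> \<Omega>"
  shows "Delta1 (act_u G \<eta> \<Omega> u v) (act_v G \<eta> \<Omega> u v) (X p) = q p ^ 3 / (d + h * e) * Delta1 u v p"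
    and "Delta2 (act_u G \<eta> \<Omega> u v) (act_v G \<eta> \<Omega> u v) (X p) =
      q p ^ 3 / (d + h * e) * (w p * Delta1 u v p + k p * Delta2 u v p)"
proof -
  have "u differentiable (at p)" "v differentiable (at p)"
    using assms by (meson smooth_on_differentiable)+
  note * = Delta_transform[OF q_pos[OF assms(3)] this]
  note ** = Delta_cong[OF open_image imageI[OF assms(3)] act_eq]
  show "Delta1 (act_u G \<eta> \<Omega> u v) (act_v G \<eta> \<Omega> u v) (X p) = q p ^ 3 / (d + h * e) * Delta1 u v p"
    unfolding *(1)[symmetric] by (rule **(1))
  show "Delta2 (act_u G \<eta> \<Omega> u v) (act_v G \<eta> \<Omega> u v) (X p) =
      q p ^ 3 / (d + h * e) * (w p * Delta1 u v p + k p * Delta2 u v p)"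
    unfolding *(2)[symmetric] by (rule **(2))
qed

lemma classical_solution_act:
  assumes "classical_solution \<Omega> u v"
  shows "classical_solution (Xi G \<eta> ` \<Omega>) (act_u G \<eta> \<Omega> u v) (act_v G \<eta> \<Omega> u v)"
proof -
  have uv: "smooth_on \<Omega> u" "smooth_on \<Omega> v" "\<And>p. p \<in> \<Omega> \<Longrightarrow> Delta1 u v p = 0 \<and> Delta2 u v p = 0"
    using assms by (simp_all add: classical_solution_def)
  show ?thesis
    unfolding classical_solution_def Xi_image
  proof (intro conjI ballI smooth_act uv(1,2))
    fix p' assume "p' \<in> X ` \<Omega>"
    then obtain p where p: "p \<in> \<Omega>" "p' = X p" by blast
    show "Delta1 (act_u G \<eta> \<Omega> u v) (act_v G \<eta> \<Omega> u v) p' = 0"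
      and "Delta2 (act_u G \<eta> \<Omega> u v) (act_v G \<eta> \<Omega> u v) p' = 0"
      unfolding p(2) Delta_act[OF uv(1,2) p(1)] by (simp_all add: uv(3)[OF p(1)])
  qed
qed

text \<open>The Jacobian cancels the factor q ^ 3 / (d + h e) and leaves the constant a, hence the
  multipliers a, a w and a k. The multiplier 0 fits the first equation into the same two-term
  form.\<close>

lemma integral_Delta_act:
  assumes uv: "smooth_on \<Omega> u" "smooth_on \<Omega> v" and \<phi>: "\<phi> \<in> test_functions (X ` \<Omega>)"
  shows "(LINT p:X ` \<Omega>|lborel. Delta1 (act_u G \<eta> \<Omega> u v) (act_v G \<eta> \<Omega> u v) p * \<phi> p) =
      (LINT p:\<Omega>|lborel. Delta1 u v p * pull \<Omega> (\<lambda>p. a) \<phi> p) +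
      (LINT p:\<Omega>|lborel. Delta2 u v p * pull \<Omega> (\<lambda>p. 0) \<phi> p)"
    and "(LINT p:X ` \<Omega>|lborel. Delta2 (act_u G \<eta> \<Omega> u v) (act_v G \<eta> \<Omega> u v) p * \<phi> p) =
      (LINT p:\<Omega>|lborel. Delta1 u v p * pull \<Omega> (\<lambda>p. a * w p) \<phi> p) +
      (LINT p:\<Omega>|lborel. Delta2 u v p * pull \<Omega> (\<lambda>p. a * k p) \<phi> p)"
proof -
  have scale: "a * (d + h * e) / q p ^ 3 * (q p ^ 3 / (d + h * e) * z) = a * z" if "p \<in> \<Omega>" for p z
    using q_pos[OF that] det_pos by simp
  note cont = smooth_on_Delta(1)[OF \<Omega>(1) uv, THEN smooth_on_continuous]
    smooth_on_Delta(2)[OF \<Omega>(1) uv, THEN smooth_on_continuous]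
  note cont' = smooth_on_Delta(1)[OF open_image smooth_act[OF uv], THEN smooth_on_continuous]
    smooth_on_Delta(2)[OF open_image smooth_act[OF uv], THEN smooth_on_continuous]
  show "(LINT p:X ` \<Omega>|lborel. Delta1 (act_u G \<eta> \<Omega> u v) (act_v G \<eta> \<Omega> u v) p * \<phi> p) =
      (LINT p:\<Omega>|lborel. Delta1 u v p * pull \<Omega> (\<lambda>p. a) \<phi> p) +
      (LINT p:\<Omega>|lborel. Delta2 u v p * pull \<Omega> (\<lambda>p. 0) \<phi> p)"
  proof (rule integral_pull[OF \<Omega>(1) dom_pos \<phi> cont'(1) cont smooth_on_const smooth_on_const])
    fix p assume p: "p \<in> \<Omega>"
    show "a * (d + h * e) / q p ^ 3 * Delta1 (act_u G \<eta> \<Omega> u v) (act_v G \<eta> \<Omega> u v) (X p) =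
        a * Delta1 u v p + 0 * Delta2 u v p"
      unfolding Delta_act[OF uv p] scale[OF p] by simp
  qed
  have "smooth_on \<Omega> (\<lambda>p. a * w p)" "smooth_on \<Omega> (\<lambda>p. a * k p)"
    by (intro smooth_on_mult smooth_on_const smooth_on_w smooth_on_k \<Omega>(1))+
  then show "(LINT p:X ` \<Omega>|lborel. Delta2 (act_u G \<eta> \<Omega> u v) (act_v G \<eta> \<Omega> u v) p * \<phi> p) =
      (LINT p:\<Omega>|lborel. Delta1 u v p * pull \<Omega> (\<lambda>p. a * w p) \<phi> p) +
      (LINT p:\<Omega>|lborel. Delta2 u v p * pull \<Omega> (\<lambda>p. a * k p) \<phi> p)"
  proof (rule integral_pull[OF \<Omega>(1) dom_pos \<phi> cont'(2) cont])
    fix p assume p: "p \<in> \<Omega>"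
    show "a * (d + h * e) / q p ^ 3 * Delta2 (act_u G \<eta> \<Omega> u v) (act_v G \<eta> \<Omega> u v) (X p) =
        a * w p * Delta1 u v p + a * k p * Delta2 u v p"
      unfolding Delta_act[OF uv p] scale[OF p] by (simp add: algebra_simps)
  qed
qed

text \<open>The transforms of the given witnesses serve as witnesses. A bounded set of test
  functions on the image is pulled back to two bounded sets on \<Omega>, where the limits are known,
  and the supremum for the image is at most the sum of the two suprema.\<close>

lemma strongly_assoc_solution_act:
  assumes UV: "strongly_assoc_solution \<Omega> U V"
  shows "strongly_assoc_solution (Xi G \<eta> ` \<Omega>) (gact_u G \<eta> \<Omega> U V) (gact_v G \<eta> \<Omega> U V)"
proof -
  from UV obtain u v where U: "U \<in> colombeau \<Omega>" and V: "V \<in> colombeau \<Omega>" and uv: "u \<in> U" "v \<in> V"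
    and lim: "\<And>B \<Delta>. B \<subseteq> test_functions \<Omega> \<Longrightarrow> bounded_in_C1c \<Omega> B \<Longrightarrow> \<Delta> \<in> {Delta1, Delta2} \<Longrightarrow>
      ((\<lambda>\<epsilon>. SUP \<phi>\<in>B. ennreal \<bar>LINT p:\<Omega>|lborel. \<Delta> (u \<epsilon>) (v \<epsilon>) p * \<phi> p\<bar>) \<longlongrightarrow> 0) (at_right 0)"
    unfolding strongly_assoc_solution_def by blast
  let ?u = "\<lambda>\<epsilon>. act_u G \<eta> \<Omega> (u \<epsilon>) (v \<epsilon>)" and ?v = "\<lambda>\<epsilon>. act_v G \<eta> \<Omega> (u \<epsilon>) (v \<epsilon>)"
  have smooth: "smooth_on \<Omega> (u \<epsilon>)" "smooth_on \<Omega> (v \<epsilon>)" if "\<epsilon> \<in> {0<..1}" for \<epsilon>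
    using moderate_nets_smooth[OF colombeau_moderate[OF \<Omega>(1)] that] U V uv by blast+
  have Fu: "act_u G \<eta> \<Omega> f g p = 0 + (q (Y p) * f (Y p) + 0 * g (Y p))"
    and Fv: "act_v G \<eta> \<Omega> f g p = w (Y p) + (0 * f (Y p) + k (Y p) * g (Y p))"
    if "p \<in> X ` \<Omega>" for f g p
    by (simp_all add: act_eq[OF that])
  note Cu = affine_pullback_colombeau[where F = "\<lambda>u v \<epsilon>. act_u G \<eta> \<Omega> (u \<epsilon>) (v \<epsilon>)"
      and \<kappa>\<^sub>0 = "\<lambda>p. 0" and \<kappa>\<^sub>2 = "\<lambda>p. 0", OF \<Omega>(1) open_image Y_image smooth_Y smooth_on_const
      smooth_compose_Y[OF smooth_on_q[OF \<Omega>(1)]] smooth_on_const U V Fu]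
    and Cv = affine_pullback_colombeau[where F = "\<lambda>u v \<epsilon>. act_v G \<eta> \<Omega> (u \<epsilon>) (v \<epsilon>)"
      and \<kappa>\<^sub>1 = "\<lambda>p. 0", OF \<Omega>(1) open_image Y_image smooth_Y
      smooth_compose_Y[OF smooth_on_w[OF \<Omega>(1)]] smooth_on_const
      smooth_compose_Y[OF smooth_on_k[OF \<Omega>(1)]] U V Fv]
  \<comment> \<open>Both equations differ only in the multipliers, so one estimate serves for
    both.\<close>
  have transfer: "((\<lambda>\<epsilon>. SUP \<phi>\<in>B. ennreal \<bar>LINT p:X ` \<Omega>|lborel. \<Delta> (?u \<epsilon>) (?v \<epsilon>) p * \<phi> p\<bar>) \<longlongrightarrow> 0) (at_right 0)"
    if B: "B \<subseteq> test_functions (X ` \<Omega>)" "bounded_in_C1c (X ` \<Omega>) B"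
      and \<kappa>: "smooth_on \<Omega> \<kappa>\<^sub>1" "smooth_on \<Omega> \<kappa>\<^sub>2"
      and eq: "\<And>\<epsilon> \<phi>. \<epsilon> \<in> {0<..1} \<Longrightarrow> \<phi> \<in> B \<Longrightarrow>
        (LINT p:X ` \<Omega>|lborel. \<Delta> (?u \<epsilon>) (?v \<epsilon>) p * \<phi> p) =
        (LINT p:\<Omega>|lborel. Delta1 (u \<epsilon>) (v \<epsilon>) p * pull \<Omega> \<kappa>\<^sub>1 \<phi> p) +
        (LINT p:\<Omega>|lborel. Delta2 (u \<epsilon>) (v \<epsilon>) p * pull \<Omega> \<kappa>\<^sub>2 \<phi> p)"
    for B \<Delta> \<kappa>\<^sub>1 \<kappa>\<^sub>2
  proof -
    let ?S = "\<lambda>\<Delta> B \<epsilon>. SUP \<phi>\<in>B. ennreal \<bar>LINT p:\<Omega>|lborel. \<Delta> (u \<epsilon>) (v \<epsilon>) p * \<phi> p\<bar>"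
    have test: "pull \<Omega> \<kappa> ` B \<subseteq> test_functions \<Omega>" if "smooth_on \<Omega> \<kappa>" for \<kappa>
      using pull_test_functions[OF \<Omega>(1) dom_pos that] B(1) by blast
    have "((\<lambda>\<epsilon>. ?S Delta1 (pull \<Omega> \<kappa>\<^sub>1 ` B) \<epsilon> + ?S Delta2 (pull \<Omega> \<kappa>\<^sub>2 ` B) \<epsilon>) \<longlongrightarrow> 0 + 0) (at_right 0)"
      by (intro tendsto_add lim test pull_bounded_in_C1c \<Omega>(1) dom_pos \<kappa> B) simp_all
    then have lim': "((\<lambda>\<epsilon>. ?S Delta1 (pull \<Omega> \<kappa>\<^sub>1 ` B) \<epsilon> + ?S Delta2 (pull \<Omega> \<kappa>\<^sub>2 ` B) \<epsilon>) \<longlongrightarrow> 0) (at_right 0)"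
      by simp
    have le: "(SUP \<phi>\<in>B. ennreal \<bar>LINT p:X ` \<Omega>|lborel. \<Delta> (?u \<epsilon>) (?v \<epsilon>) p * \<phi> p\<bar>) \<le>
        ?S Delta1 (pull \<Omega> \<kappa>\<^sub>1 ` B) \<epsilon> + ?S Delta2 (pull \<Omega> \<kappa>\<^sub>2 ` B) \<epsilon>" if \<epsilon>: "\<epsilon> \<in> {0<..1}" for \<epsilon>
    proof (rule SUP_least)
      fix \<phi> assume \<phi>: "\<phi> \<in> B"
      let ?I1 = "LINT p:\<Omega>|lborel. Delta1 (u \<epsilon>) (v \<epsilon>) p * pull \<Omega> \<kappa>\<^sub>1 \<phi> p"
        and ?I2 = "LINT p:\<Omega>|lborel. Delta2 (u \<epsilon>) (v \<epsilon>) p * pull \<Omega> \<kappa>\<^sub>2 \<phi> p"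
      have "ennreal \<bar>LINT p:X ` \<Omega>|lborel. \<Delta> (?u \<epsilon>) (?v \<epsilon>) p * \<phi> p\<bar> \<le> ennreal (\<bar>?I1\<bar> + \<bar>?I2\<bar>)"
        unfolding eq[OF \<epsilon> \<phi>] by (rule ennreal_leI) (rule abs_triangle_ineq)
      also have "\<dots> = ennreal \<bar>?I1\<bar> + ennreal \<bar>?I2\<bar>" by (rule ennreal_plus) simp_all
      also have "\<dots> \<le> ?S Delta1 (pull \<Omega> \<kappa>\<^sub>1 ` B) \<epsilon> + ?S Delta2 (pull \<Omega> \<kappa>\<^sub>2 ` B) \<epsilon>"
        by (intro add_mono SUP_upper imageI \<phi>)
      finally show "ennreal \<bar>LINT p:X ` \<Omega>|lborel. \<Delta> (?u \<epsilon>) (?v \<epsilon>) p * \<phi> p\<bar> \<le>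
        ?S Delta1 (pull \<Omega> \<kappa>\<^sub>1 ` B) \<epsilon> + ?S Delta2 (pull \<Omega> \<kappa>\<^sub>2 ` B) \<epsilon>" .
    qed
    show ?thesis
      \<comment> \<open>The comparison holds for \<epsilon> in (0, 1] only, where the nets are
        smooth; this suffices for the limit at 0 from the right.\<close>
      by (rule tendsto_sandwich[OF _ eventually_mono[OF eventually_unit_interval le] tendsto_const lim']) simp_all
  qed
  show ?thesis
    unfolding strongly_assoc_solution_def Xi_image
  proof (intro conjI bexI allI impI ballI)
    show "gact_u G \<eta> \<Omega> U V \<in> colombeau (X ` \<Omega>)"
      unfolding gact_u_def Xi_image by (rule Cu(1))
    show "gact_v G \<eta> \<Omega> U V \<in> colombeau (X ` \<Omega>)"
      unfolding gact_v_def Xi_image by (rule Cv(1))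
    show "?u \<in> gact_u G \<eta> \<Omega> U V"
      unfolding gact_u_def Xi_image by (rule Cu(2)) (assumption | rule uv)+
    show "?v \<in> gact_v G \<eta> \<Omega> U V"
      unfolding gact_v_def Xi_image by (rule Cv(2)) (assumption | rule uv)+
    fix B \<Delta> assume B: "B \<subseteq> test_functions (X ` \<Omega>)" "bounded_in_C1c (X ` \<Omega>) B"
      and "\<Delta> \<in> {Delta1, Delta2}"
    then consider "\<Delta> = Delta1" | "\<Delta> = Delta2" by blast
    then show "((\<lambda>\<epsilon>. SUP \<phi>\<in>B. ennreal \<bar>LINT p:X ` \<Omega>|lborel. \<Delta> (?u \<epsilon>) (?v \<epsilon>) p * \<phi> p\<bar>) \<longlongrightarrow> 0) (at_right 0)"
    proof cases
      case 1
      show ?thesis unfolding 1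
        by (rule transfer[OF B smooth_on_const smooth_on_const integral_Delta_act(1)[OF smooth]])
          (use B(1) in blast)+
    next
      case 2
      have "smooth_on \<Omega> (\<lambda>p. a * w p)" "smooth_on \<Omega> (\<lambda>p. a * k p)"
        by (intro smooth_on_mult smooth_on_const smooth_on_w smooth_on_k \<Omega>(1))+
      then show ?thesis unfolding 2
        by (rule transfer[OF B _ _ integral_Delta_act(2)[OF smooth]]) (use B(1) in blast)+
    qed
  qed
qed

end

end

section \<open>From single maps to groups\<close>

text \<open>Both symmetry properties concern one \<eta> at a time, so it is enough to represent each
  map separately.\<close>

lemma strongly_assoc_symmetry_groupI:
  assumes "local_transformation_group G"
    and rep: "\<And>\<eta>. \<exists>a b c d e h. galilean_projective a d e h \<and> galilean_projective.represents a b c d e h G \<eta>"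
  shows "strongly_assoc_symmetry_group G"
proof -
  have *: "classical_solution \<Omega> u v \<Longrightarrow>
        classical_solution (Xi G \<eta> ` \<Omega>) (act_u G \<eta> \<Omega> u v) (act_v G \<eta> \<Omega> u v)"
      "strongly_assoc_solution \<Omega> U V \<Longrightarrow>
        strongly_assoc_solution (Xi G \<eta> ` \<Omega>) (gact_u G \<eta> \<Omega> U V) (gact_v G \<eta> \<Omega> U V)"
    if "open \<Omega>" "\<Omega> \<subseteq> Dmn G \<eta>" for \<eta> \<Omega> u v U V
  proof -
    from rep obtain a b c d e h where
      1: "galilean_projective a d e h" and 2: "galilean_projective.represents a b c d e h G \<eta>"
      by blast
    show "classical_solution \<Omega> u v \<Longrightarrow>
        classical_solution (Xi G \<eta> ` \<Omega>) (act_u G \<eta> \<Omega> u v) (act_v G \<eta> \<Omega> u v)"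
      by (rule galilean_projective.classical_solution_act[OF 1 2 that])
    show "strongly_assoc_solution \<Omega> U V \<Longrightarrow>
        strongly_assoc_solution (Xi G \<eta> ` \<Omega>) (gact_u G \<eta> \<Omega> U V) (gact_v G \<eta> \<Omega> U V)"
      by (rule galilean_projective.strongly_assoc_solution_act[OF 1 2 that])
  qed
  show ?thesis
    unfolding strongly_assoc_symmetry_group_def symmetry_group_def
    by (intro conjI assms(1) allI impI *)
qed

lemma local_transformation_groupI:
  assumes dmn: "open {(\<eta>, p). p \<in> Dmn G \<eta>}" "Dmn G 0 = UNIV"
    and smooth: "smooth_on {(\<eta>, p, w). p \<in> Dmn G \<eta>} (\<lambda>(\<eta>, p, w). (Xi G \<eta> p, Phi G \<eta> p w))"
    and zero: "\<And>x t u v. Xi G 0 (x, t) = (x, t) \<and> Phi G 0 (x, t) (u, v) = (u, v)"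
    and comp: "\<And>\<eta> \<mu> x t u v. (x, t) \<in> Dmn G \<mu> \<Longrightarrow> Xi G \<mu> (x, t) \<in> Dmn G \<eta> \<Longrightarrow> (x, t) \<in> Dmn G (\<eta> + \<mu>) \<Longrightarrow>
      Xi G \<eta> (Xi G \<mu> (x, t)) = Xi G (\<eta> + \<mu>) (x, t) \<and>
      Phi G \<eta> (Xi G \<mu> (x, t)) (Phi G \<mu> (x, t) (u, v)) = Phi G (\<eta> + \<mu>) (x, t) (u, v)"
    and inv: "\<And>\<eta> x t. (x, t) \<in> Dmn G \<eta> \<Longrightarrow> Xi G \<eta> (x, t) \<in> Dmn G (- \<eta>)"
  shows "local_transformation_group G"
  unfolding local_transformation_group_def
  using dmn smooth zero comp inv by (simp only: split_paired_all split_paired_All) blast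

subsection \<open>The six groups\<close>

text \<open>Tuples (\<eta>, (x, t), u, v): the group axioms ask for joint smoothness, so the
  parameter counts as a coordinate.\<close>

type_synonym jet = "real \<times> point \<times> real \<times> real"

lemma smooth_on_jet:
  "smooth_on S (\<lambda>z :: jet. fst z)"
  "smooth_on S (\<lambda>z :: jet. fst (fst (snd z)))"
  "smooth_on S (\<lambda>z :: jet. snd (fst (snd z)))"
  "smooth_on S (\<lambda>z :: jet. fst (snd (snd z)))"
  "smooth_on S (\<lambda>z :: jet. snd (snd (snd z)))"
  by (intro smooth_on_linear bounded_linear_fst_comp bounded_linear_snd_comp bounded_linear_ident)+

lemma local_transformation_groups_global:
  "local_transformation_group G1" "local_transformation_group G2" "local_transformation_group G3"
  "local_transformation_group G6" "local_transformation_group G7"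
proof -
  show "local_transformation_group G1"
  proof (rule local_transformation_groupI)
    have "smooth_on UNIV (\<lambda>z :: jet. ((fst (fst (snd z)) + fst z, snd (fst (snd z))), (fst (snd (snd z)), snd (snd (snd z)))))"
      by (intro smooth_on_intros smooth_on_jet open_UNIV)
    then show "smooth_on {(\<eta>, p, w). p \<in> Dmn G1 \<eta>} (\<lambda>(\<eta>, p, w). (Xi G1 \<eta> p, Phi G1 \<eta> p w))"
      by (simp add: G1_def case_prod_beta' split_def)
  qed (simp_all add: G1_def)
  show "local_transformation_group G2"
  proof (rule local_transformation_groupI)
    have "smooth_on UNIV (\<lambda>z :: jet. ((exp (fst z) * fst (fst (snd z)), snd (fst (snd z))), (fst (snd (snd z)), exp (fst z) * snd (snd (snd z)))))"
      by (intro smooth_on_intros smooth_on_jet open_UNIV)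
    then show "smooth_on {(\<eta>, p, w). p \<in> Dmn G2 \<eta>} (\<lambda>(\<eta>, p, w). (Xi G2 \<eta> p, Phi G2 \<eta> p w))"
      by (simp add: G2_def case_prod_beta' split_def)
  qed (simp_all add: G2_def exp_add)
  show "local_transformation_group G3"
  proof (rule local_transformation_groupI)
    have "smooth_on UNIV (\<lambda>z :: jet. ((fst (fst (snd z)) + fst z * snd (fst (snd z)), snd (fst (snd z))), (fst (snd (snd z)), snd (snd (snd z)) + fst z)))"
      by (intro smooth_on_intros smooth_on_jet open_UNIV)
    then show "smooth_on {(\<eta>, p, w). p \<in> Dmn G3 \<eta>} (\<lambda>(\<eta>, p, w). (Xi G3 \<eta> p, Phi G3 \<eta> p w))"
      by (simp add: G3_def case_prod_beta' split_def)
  qed (simp_all add: G3_def algebra_simps)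
  show "local_transformation_group G6"
  proof (rule local_transformation_groupI)
    have "smooth_on UNIV (\<lambda>z :: jet. ((fst (fst (snd z)), snd (fst (snd z)) + fst z), (fst (snd (snd z)), snd (snd (snd z)))))"
      by (intro smooth_on_intros smooth_on_jet open_UNIV)
    then show "smooth_on {(\<eta>, p, w). p \<in> Dmn G6 \<eta>} (\<lambda>(\<eta>, p, w). (Xi G6 \<eta> p, Phi G6 \<eta> p w))"
      by (simp add: G6_def case_prod_beta' split_def)
  qed (simp_all add: G6_def)
  show "local_transformation_group G7"
  proof (rule local_transformation_groupI)
    have "smooth_on UNIV (\<lambda>z :: jet. ((fst (fst (snd z)), exp (fst z) * snd (fst (snd z))), (fst (snd (snd z)), exp (- fst z) * snd (snd (snd z)))))"
      by (intro smooth_on_intros smooth_on_jet open_UNIV)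
    then show "smooth_on {(\<eta>, p, w). p \<in> Dmn G7 \<eta>} (\<lambda>(\<eta>, p, w). (Xi G7 \<eta> p, Phi G7 \<eta> p w))"
      by (simp add: G7_def case_prod_beta' split_def)
  qed (simp_all add: G7_def exp_add[symmetric] mult.assoc[symmetric] add.commute)
qed

text \<open>The composition law rests on the cocycle identity (1 - \<eta> t / (1 - \<mu> t)) (1 -
  \<mu> t) = 1 - (\<eta> + \<mu>) t for the denominators; for the velocity an additional rational
  identity is needed.\<close>

lemma local_transformation_group_G8: "local_transformation_group G8"
proof (rule local_transformation_groupI)
  let ?q = "\<lambda>z :: jet. 1 - fst z * snd (fst (snd z))"
  have "{(\<eta>, p). p \<in> Dmn G8 \<eta>} = {z. 0 < 1 - fst z * snd (snd z)}"
    by (auto simp: G8_def)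
  moreover have "open {z :: real \<times> point. 0 < 1 - fst z * snd (snd z)}"
    by (intro open_Collect_less continuous_intros)
  ultimately show "open {(\<eta>, p). p \<in> Dmn G8 \<eta>}" by simp
  have dmn: "{(\<eta>, p, w). p \<in> Dmn G8 \<eta>} = {z. 0 < ?q z}"
    by (auto simp: G8_def)
  have "open {z. 0 < ?q z}"
    by (intro open_Collect_less continuous_intros)
  then have "smooth_on {z. 0 < ?q z} (\<lambda>z :: jet. ((fst (fst (snd z)) / ?q z, snd (fst (snd z)) / ?q z),
      (?q z * fst (snd (snd z)), fst z * fst (fst (snd z)) + ?q z * snd (snd (snd z)))))"
    by (intro smooth_on_intros smooth_on_jet) auto
  then show "smooth_on {(\<eta>, p, w). p \<in> Dmn G8 \<eta>} (\<lambda>(\<eta>, p, w). (Xi G8 \<eta> p, Phi G8 \<eta> p w))"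
    unfolding dmn by (simp add: G8_def case_prod_beta' split_def)
  show "Dmn G8 0 = UNIV" by (simp add: G8_def)
  show "Xi G8 0 (x, t) = (x, t) \<and> Phi G8 0 (x, t) (u, v) = (u, v)" for x t u v
    by (simp add: G8_def)
  fix \<eta> x t
  show "Xi G8 \<eta> (x, t) \<in> Dmn G8 (- \<eta>)" if "(x, t) \<in> Dmn G8 \<eta>"
    using that by (simp add: G8_def field_simps)
  fix \<mu> u v
  assume *: "(x, t) \<in> Dmn G8 \<mu>" "Xi G8 \<mu> (x, t) \<in> Dmn G8 \<eta>" "(x, t) \<in> Dmn G8 (\<eta> + \<mu>)"
  let ?m = "1 - \<mu> * t" and ?s = "1 - (\<eta> + \<mu>) * t"
  have m: "0 < ?m" and s: "0 < ?s" using *(1,3) by (simp_all add: G8_def)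
  have q: "1 - \<eta> * (t / ?m) = ?s / ?m" using m by (simp add: field_simps)
  have X: "\<eta> * (x / ?m) + ?s / ?m * (\<mu> * x + ?m * v) = (\<eta> + \<mu>) * x + ?s * v"
    using m by (simp add: divide_simps) (simp add: algebra_simps)
  show "Xi G8 \<eta> (Xi G8 \<mu> (x, t)) = Xi G8 (\<eta> + \<mu>) (x, t) \<and>
      Phi G8 \<eta> (Xi G8 \<mu> (x, t)) (Phi G8 \<mu> (x, t) (u, v)) = Phi G8 (\<eta> + \<mu>) (x, t) (u, v)"
    using m s unfolding G8_def transformations.simps prod.case q X by simp
qed

lemma strongly_assoc_symmetry_group_G1: "strongly_assoc_symmetry_group G1"
proof (rule strongly_assoc_symmetry_groupI[OF local_transformation_groups_global(1)])
  fix \<eta> :: real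
  interpret galilean_projective 1 0 \<eta> 1 0 0
    by unfold_locales simp_all
  have "represents G1 \<eta>"
    by (simp add: represents_def q_def X_def w_def k_def G1_def split_def exp_minus field_simps)
  then show "\<exists>a b c d e h. galilean_projective a d e h \<and> galilean_projective.represents a b c d e h G1 \<eta>"
    using galilean_projective_axioms by blast
qed

lemma strongly_assoc_symmetry_group_G2: "strongly_assoc_symmetry_group G2"
proof (rule strongly_assoc_symmetry_groupI[OF local_transformation_groups_global(2)])
  fix \<eta> :: real
  interpret galilean_projective "exp \<eta>" 0 0 1 0 0
    by unfold_locales simp_all
  have "represents G2 \<eta>"
    by (simp add: represents_def q_def X_def w_def k_def G2_def split_def exp_minus field_simps)
  then show "\<exists>a b c d e h. galilean_projective a d e h \<and> galilean_projective.represents a b c d e h G2 \<eta>"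
    using galilean_projective_axioms by blast
qed

text \<open>A Galilean boost: \<open>w\<close> is the constant \<eta>, so the second equation
  acquires \<eta> times the first.\<close>

lemma strongly_assoc_symmetry_group_G3: "strongly_assoc_symmetry_group G3"
proof (rule strongly_assoc_symmetry_groupI[OF local_transformation_groups_global(3)])
  fix \<eta> :: real
  interpret galilean_projective 1 \<eta> 0 1 0 0
    by unfold_locales simp_all
  have "represents G3 \<eta>"
    by (simp add: represents_def q_def X_def w_def k_def G3_def split_def exp_minus field_simps)
  then show "\<exists>a b c d e h. galilean_projective a d e h \<and> galilean_projective.represents a b c d e h G3 \<eta>"
    using galilean_projective_axioms by blast
qed

lemma strongly_assoc_symmetry_group_G6: "strongly_assoc_symmetry_group G6"
proof (rule strongly_assoc_symmetry_groupI[OF local_transformation_groups_global(4)])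
  fix \<eta> :: real
  interpret galilean_projective 1 0 0 1 \<eta> 0
    by unfold_locales simp_all
  have "represents G6 \<eta>"
    by (simp add: represents_def q_def X_def w_def k_def G6_def split_def exp_minus field_simps)
  then show "\<exists>a b c d e h. galilean_projective a d e h \<and> galilean_projective.represents a b c d e h G6 \<eta>"
    using galilean_projective_axioms by blast
qed

lemma strongly_assoc_symmetry_group_G7: "strongly_assoc_symmetry_group G7"
proof (rule strongly_assoc_symmetry_groupI[OF local_transformation_groups_global(5)])
  fix \<eta> :: real
  \<comment> \<open>Dilating time by d makes k = 1 / d, the reciprocal factor on the
    velocity.\<close>
  interpret galilean_projective 1 0 0 "exp \<eta>" 0 0
    by unfold_locales simp_all
  have "represents G7 \<eta>"
    by (simp add: represents_def q_def X_def w_def k_def G7_def split_def exp_minus field_simps)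
  then show "\<exists>a b c d e h. galilean_projective a d e h \<and> galilean_projective.represents a b c d e h G7 \<eta>"
    using galilean_projective_axioms by blast
qed

lemma strongly_assoc_symmetry_group_G8: "strongly_assoc_symmetry_group G8"
proof (rule strongly_assoc_symmetry_groupI[OF local_transformation_group_G8])
  fix \<eta> :: real
  \<comment> \<open>Here h = \<eta> gives q = k = 1 - \<eta> t and w = \<eta> x; in the other five
    groups these three functions are constant.\<close>
  interpret galilean_projective 1 0 0 1 0 \<eta>
    by unfold_locales simp_all
  have "represents G8 \<eta>"
    by (simp add: represents_def q_def X_def w_def k_def G8_def split_def exp_minus field_simps)
  then show "\<exists>a b c d e h. galilean_projective a d e h \<and> galilean_projective.represents a b c d e h G8 \<eta>"
    using galilean_projective_axioms by blast
qed

theorem theorem2p5: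
  shows "strongly_assoc_symmetry_group G1 \<and>
         strongly_assoc_symmetry_group G2 \<and>
         strongly_assoc_symmetry_group G3 \<and>
         strongly_assoc_symmetry_group G6 \<and>
         strongly_assoc_symmetry_group G7 \<and>
         strongly_assoc_symmetry_group G8"
  by (intro conjI strongly_assoc_symmetry_group_G1 strongly_assoc_symmetry_group_G2
      strongly_assoc_symmetry_group_G3 strongly_assoc_symmetry_group_G6
      strongly_assoc_symmetry_group_G7 strongly_assoc_symmetry_group_G8)

end
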